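(* Let $\kappa>\frac12$. For every probability measure $\mu$ on $(-1,1)$ and every $s\ge 0$, $$\lim_{t\to\infty}\mathbb{P}_{\mu,s}(X_t\in\cdot\mid \tau_X>t)=\delta_0,$$ where the limit is in the sense of weak convergence of probability measures.
   Context: Let $\kappa>0$. For $s\ge 0$ and $x\in\mathbb{R}$, let $\mathbb{P}_{x,s}$ be a probability measure under which the process $(X_t)_{t\ge s}$ is given by $X_t=\frac{x(s+1)^\kappa+W_{t-s}}{(t+1)^\kappa}$, where $(W_u)_{u\ge0}$ is a standard one-dimensional Brownian motion started at $0$; equivalently $X_t=B_t/(t+1)^\kappa$ with $B$ a Brownian motion satisfying $B_s=x(s+1)^\kappa$, so that $\mathbb{P}_{x,s}(X_s=x)=1$. Let $\tau_X:=\inf\{t\ge s:|X_t|=1\}$. For a probability measure $\mu$ on $(-1,1)$, $\mathbb{P}_{\mu,s}:=\int\mathbb{P}_{x,s}\,\mu(dx)$. $\delta_0$ is the Dirac mass at $0$. *)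

theory Defs
  imports "HOL-Probability.Probability"
begin

definition brownian_motion :: "'a measure \<Rightarrow> (real \<Rightarrow> 'a \<Rightarrow> real) \<Rightarrow> bool" where
  "brownian_motion M W \<longleftrightarrow>
     prob_space M \<and>
     (\<forall>t\<ge>0. W t \<in> borel_measurable M) \<and>
     (\<forall>\<omega>\<in>space M. W 0 \<omega> = 0) \<and>
     (\<forall>\<omega>\<in>space M. continuous_on {0..} (\<lambda>t. W t \<omega>)) \<and>
     (\<forall>r t. 0 \<le> r \<and> r < t \<longrightarrow>
        distributed M lborel (\<lambda>\<omega>. W t \<omega> - W r \<omega>) (normal_density 0 (sqrt (t - r)))) \<and>
     (\<forall>(n::nat) (ts::nat \<Rightarrow> real). 0 \<le> ts 0 \<and> (\<forall>i<n. ts i < ts (Suc i)) \<longrightarrow>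
        prob_space.indep_vars M (\<lambda>_. borel) (\<lambda>i \<omega>. W (ts (Suc i)) \<omega> - W (ts i) \<omega>) {..<n})"

definition Xproc :: "real \<Rightarrow> real \<Rightarrow> real \<Rightarrow> (real \<Rightarrow> 'a \<Rightarrow> real) \<Rightarrow> real \<Rightarrow> 'a \<Rightarrow> real" where
  "Xproc \<kappa> s x W t \<omega> = (x * (s + 1) powr \<kappa> + W (t - s) \<omega>) / (t + 1) powr \<kappa>"

definition hit_time :: "real \<Rightarrow> real \<Rightarrow> real \<Rightarrow> (real \<Rightarrow> 'a \<Rightarrow> real) \<Rightarrow> 'a \<Rightarrow> ereal" where
  "hit_time \<kappa> s x W \<omega> = Inf (ereal ` {t. t \<ge> s \<and> \<bar>Xproc \<kappa> s x W t \<omega>\<bar> = 1})"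

definition surv_prob :: "'a measure \<Rightarrow> (real \<Rightarrow> 'a \<Rightarrow> real) \<Rightarrow> real measure \<Rightarrow> real \<Rightarrow> real \<Rightarrow> real \<Rightarrow> real" where
  "surv_prob M W \<mu> \<kappa> s t =
     (\<integral>x. measure M {\<omega>\<in>space M. hit_time \<kappa> s x W \<omega> > ereal t} \<partial>\<mu>)"

definition surv_expect :: "'a measure \<Rightarrow> (real \<Rightarrow> 'a \<Rightarrow> real) \<Rightarrow> real measure \<Rightarrow> real \<Rightarrow> real \<Rightarrow> (real \<Rightarrow> real) \<Rightarrow> real \<Rightarrow> real" where
  "surv_expect M W \<mu> \<kappa> s f t =
     (\<integral>x. (\<integral>\<omega>. f (Xproc \<kappa> s x W t \<omega>) *
              indicator {\<omega>\<in>space M. hit_time \<kappa> s x W \<omega> > ereal t} \<omega> \<partial>M) \<partial>\<mu>)"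

text \<open>E_{mu,s}[f(X_t) | tau_X > t], i.e. the integral of f against the conditional law.\<close>
definition cond_expect :: "'a measure \<Rightarrow> (real \<Rightarrow> 'a \<Rightarrow> real) \<Rightarrow> real measure \<Rightarrow> real \<Rightarrow> real \<Rightarrow> (real \<Rightarrow> real) \<Rightarrow> real \<Rightarrow> real" where
  "cond_expect M W \<mu> \<kappa> s f t = surv_expect M W \<mu> \<kappa> s f t / surv_prob M W \<mu> \<kappa> s t"

end

theory Submission
  imports Defs
begin

text \<open>Since \<open>\<kappa> > 1/2\<close>, the boundary \<open>(t + 1) powr \<kappa>\<close> outgrows Brownian motion, so the survival
  probability stays bounded away from \<open>0\<close>. As \<open>X\<^sub>t\<close> tends to \<open>0\<close> in probability even without the
  conditioning, the conditional laws converge to the Dirac mass at \<open>0\<close>.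

  For the lower bound, up to a large time \<open>T\<close> the path is kept in a narrow tube by \<open>N\<close> independent
  blocks of length \<open>T / N\<close>, each of oscillation at most \<open>e\<close> and total increment at most \<open>e / N\<close>:
  the constraint on the increment has probability of order \<open>N powr (- 1/2)\<close>, that on the
  oscillation fails with probability of order \<open>N powr (- 2)\<close>. After \<open>T\<close>, a union bound over the
  intervals \<open>[T, T + T * 2 ^ k]\<close> shows that \<open>W\<^sub>u - W\<^sub>T\<close> outgrows \<open>u powr \<kappa> / 2\<close> with probability at
  most \<open>1/2\<close>.\<close>

section \<open>Continuous functions on dyadic grids\<close>

text \<open>The grid points just left of \<open>u\<close> converge to \<open>u\<close>, so
  continuity carries the inequality over. The mesh \<open>h\<close> is free and \<open>q\<close>
  need not be a grid point, so the grid can be aligned with whatever blocks are in use.\<close>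

lemma continuous_on_le_from_dyadic_grid:
  fixes g :: "real \<Rightarrow> real"
  assumes cont: "continuous_on {p..q} g" and h: "0 < h"
    and grid: "\<And>m k. p + real k * h / 2 ^ m \<le> q \<Longrightarrow> g (p + real k * h / 2 ^ m) \<le> 0"
    and u: "u \<in> {p..q}"
  shows "g u \<le> 0"
proof -
  \<comment> \<open>Index of the last grid point of level \<open>m\<close> at or before
    \<open>u\<close>; rounding down keeps that point in the interval.\<close>
  define k where "k m = nat \<lfloor>(u - p) * 2 ^ m / h\<rfloor>" for m
  define v where "v m = p + real (k m) * h / 2 ^ m" for m
  have k: "real (k m) \<le> (u - p) * 2 ^ m / h" "(u - p) * 2 ^ m / h \<le> real (k m) + 1" for m
  proof -
    have "0 \<le> (u - p) * 2 ^ m / h" using u h by auto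
    then have "real (k m) = real_of_int \<lfloor>(u - p) * 2 ^ m / h\<rfloor>"
      unfolding k_def by simp
    then show "real (k m) \<le> (u - p) * 2 ^ m / h" "(u - p) * 2 ^ m / h \<le> real (k m) + 1" by linarith+
  qed
  have v_le: "v m \<le> u" and pv: "p \<le> v m" for m
    using k(1)[of m] h by (auto simp: v_def field_simps)
  have v_ge: "u - h / 2 ^ m \<le> v m" for m
  proof -
    have "(u - p) * 2 ^ m \<le> (real (k m) + 1) * h"
      using k(2)[of m] h by (simp add: pos_divide_le_eq)
    then have "u - p \<le> (real (k m) + 1) * h / 2 ^ m"
      by (simp add: pos_le_divide_eq)
    then show ?thesis by (simp add: v_def algebra_simps add_divide_distrib)
  qed
  have "(\<lambda>m. h * (1 / 2) ^ m) \<longlonglongrightarrow> h * 0"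
    by (intro tendsto_intros) auto
  then have lim0: "(\<lambda>m. u - h / 2 ^ m) \<longlonglongrightarrow> u"
    using tendsto_diff[OF tendsto_const[of u]] by (fastforce simp: power_one_over)
  have lim: "v \<longlonglongrightarrow> u"
    by (rule tendsto_sandwich[OF _ _ lim0 tendsto_const]) (use v_le v_ge in auto)
  have "(\<lambda>m. g (v m)) \<longlonglongrightarrow> g u"
    by (rule continuous_on_tendsto_compose[OF cont lim u]) (use pv u in \<open>auto intro!: always_eventually order_trans[OF v_le]\<close>)
  moreover have "g (v m) \<le> 0" for m
    using grid[of "k m" m] v_le[of m] u by (auto simp: v_def)
  ultimately show ?thesis
    by (intro LIMSEQ_le_const2) auto
qed

text \<open>By compactness a continuous function without zeros stays away from \<open>0\<close>, and this closed
  condition only has to be tested on the dyadic grid.\<close>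
lemma nonvanishing_iff_dyadic_grid:
  fixes g :: "real \<Rightarrow> real"
  assumes cont: "continuous_on {p..q} g" and pq: "p \<le> q" and h: "0 < h"
  shows "(\<forall>u\<in>{p..q}. g u \<noteq> 0) \<longleftrightarrow>
    (\<exists>n. \<forall>m k. p + real k * h / 2 ^ m \<le> q \<longrightarrow> 1 / real (Suc n) \<le> \<bar>g (p + real k * h / 2 ^ m)\<bar>)"
proof
  assume ne: "\<forall>u\<in>{p..q}. g u \<noteq> 0"
  have "continuous_on {p..q} (\<lambda>u. \<bar>g u\<bar>)" by (intro continuous_intros cont)
  then obtain v where v: "v \<in> {p..q}" "\<And>u. u \<in> {p..q} \<Longrightarrow> \<bar>g v\<bar> \<le> \<bar>g u\<bar>"
    using continuous_attains_inf[of "{p..q}" "\<lambda>u. \<bar>g u\<bar>"] pq by auto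
  have "0 < \<bar>g v\<bar>" using ne v(1) by simp
  then obtain n where n: "1 / real (Suc n) < \<bar>g v\<bar>" using nat_approx_posE by blast
  show "\<exists>n. \<forall>m k. p + real k * h / 2 ^ m \<le> q \<longrightarrow> 1 / real (Suc n) \<le> \<bar>g (p + real k * h / 2 ^ m)\<bar>"
  proof (intro exI[of _ n] allI impI)
    fix m k :: nat assume "p + real k * h / 2 ^ m \<le> q"
    then have "p + real k * h / 2 ^ m \<in> {p..q}" using h by simp
    from v(2)[OF this] n show "1 / real (Suc n) \<le> \<bar>g (p + real k * h / 2 ^ m)\<bar>" by linarith
  qed
next
  assume "\<exists>n. \<forall>m k. p + real k * h / 2 ^ m \<le> q \<longrightarrow> 1 / real (Suc n) \<le> \<bar>g (p + real k * h / 2 ^ m)\<bar>"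
  then obtain n where
    n: "\<And>m k. p + real k * h / 2 ^ m \<le> q \<Longrightarrow> 1 / real (Suc n) \<le> \<bar>g (p + real k * h / 2 ^ m)\<bar>"
    by blast
  have c: "continuous_on {p..q} (\<lambda>u. 1 / real (Suc n) - \<bar>g u\<bar>)" by (intro continuous_intros cont)
  have le: "1 / real (Suc n) - \<bar>g (p + real k * h / 2 ^ m)\<bar> \<le> 0" if "p + real k * h / 2 ^ m \<le> q" for m k
    using n[OF that] by linarith
  show "\<forall>u\<in>{p..q}. g u \<noteq> 0"
  proof
    fix u assume u: "u \<in> {p..q}"
    have "1 / real (Suc n) - \<bar>g u\<bar> \<le> 0"
      by (rule continuous_on_le_from_dyadic_grid[OF c h _ u]) (rule le)
    moreover have "0 < 1 / real (Suc n)" by simp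
    ultimately show "g u \<noteq> 0" by auto
  qed
qed

text \<open>A point of level \<open>m + 1\<close> with even index already belongs to level
  \<open>m\<close>, and one with odd index is a single step to the right of such a point. Descending
  to \<open>r\<close> therefore uses at most one increment per level.\<close>

lemma dyadic_chaining:
  fixes f c :: "_ \<Rightarrow> real"
  assumes inc: "\<And>l j. j < 2 ^ l \<Longrightarrow> \<bar>f (r + (real j + 1) * L / 2 ^ l) - f (r + real j * L / 2 ^ l)\<bar> \<le> c l"
    and k: "k \<le> 2 ^ m"
  shows "\<bar>f (r + real k * L / 2 ^ m) - f r\<bar> \<le> (\<Sum>l\<le>m. c l)"
proof -
  have c0: "0 \<le> c l" for l using inc[of 0 l] by (auto intro: order_trans[OF abs_ge_zero])
  show ?thesis using k
  proof (induction m arbitrary: k)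
    case 0
    then have "k = 0 \<or> k = 1" by auto
    then show ?case using inc[of 0 0] c0[of 0] by auto
  next
    case (Suc m)
    define k' where "k' = k div 2"
    have k': "k' \<le> 2 ^ m" using Suc.prems by (auto simp: k'_def)
    have same: "r + real (2 * k') * L / 2 ^ Suc m = r + real k' * L / 2 ^ m" by simp
    show ?case
    proof (cases "even k")
      case True
      then have "k = 2 * k'" by (simp add: k'_def)
      then show ?thesis using Suc.IH[OF k'] c0[of "Suc m"] same by simp
    next
      case False
      then have k2: "k = 2 * k' + 1" by (simp add: k'_def)
      then have "2 * k' < 2 ^ Suc m" using Suc.prems by simp
      from inc[OF this] have
        "\<bar>f (r + real k * L / 2 ^ Suc m) - f (r + real k' * L / 2 ^ m)\<bar> \<le> c (Suc m)"
        unfolding same k2 by (simp add: add.commute)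
      then show ?thesis using Suc.IH[OF k'] by simp
    qed
  qed
qed

section \<open>Brownian increments\<close>

locale brownian_path =
  fixes M :: "'a measure" and W :: "real \<Rightarrow> 'a \<Rightarrow> real"
  assumes brownian: "brownian_motion M W"

sublocale brownian_path \<subseteq> prob_space M
  using brownian by (simp add: brownian_motion_def)

context brownian_path
begin

lemma W_measurable: "0 \<le> t \<Longrightarrow> W t \<in> borel_measurable M"
  using brownian by (simp add: brownian_motion_def)

lemma W_zero: "\<omega> \<in> space M \<Longrightarrow> W 0 \<omega> = 0"
  using brownian by (simp add: brownian_motion_def)

lemma W_continuous: "\<omega> \<in> space M \<Longrightarrow> continuous_on {0..} (\<lambda>t. W t \<omega>)"
  using brownian by (simp add: brownian_motion_def)

lemma W_increment:
  "0 \<le> r \<Longrightarrow> r < t \<Longrightarrow>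
    distributed M lborel (\<lambda>\<omega>. W t \<omega> - W r \<omega>) (normal_density 0 (sqrt (t - r)))"
  using brownian by (simp add: brownian_motion_def)

text \<open>Markov's inequality for the fourth moment. The second moment would give a bound linear
  in \<open>t - r\<close>, and the union bound over \<open>2 ^ l\<close> intervals of length
  \<open>L / 2 ^ l\<close> would then not decay in \<open>l\<close>.\<close>

lemma increment_tail:
  assumes "0 \<le> r" "r < t" "0 < e"
  shows "prob {\<omega>\<in>space M. \<bar>W t \<omega> - W r \<omega>\<bar> > e} \<le> 3 * (t - r)\<^sup>2 / e ^ 4"
proof -
  let ?X = "\<lambda>\<omega>. W t \<omega> - W r \<omega>"
  let ?d = "normal_density 0 (sqrt (t - r))"
  note D = W_increment[OF assms(1,2)]
  have \<sigma>: "0 < sqrt (t - r)" using assms by simp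
  have int: "integrable lborel (\<lambda>x. ?d x * x ^ 4)"
    using integrable_normal_moment[OF \<sigma>, of 0 4] by simp
  have i1: "integrable M (\<lambda>\<omega>. ?X \<omega> ^ 4)"
    using distributed_integrable[OF D, of "\<lambda>x. x ^ 4"] int by simp
  have "(\<integral>\<omega>. ?X \<omega> ^ 4 \<partial>M) = (\<integral>x. ?d x * x ^ 4 \<partial>lborel)"
    by (subst distributed_integral[OF D, symmetric]) auto
  \<comment> \<open>The even moment formula with \<open>k = 2\<close>: three times the squared
    variance.\<close>
  also have "\<dots> = 3 * (t - r)\<^sup>2"
    using integral_normal_moment_even[OF \<sigma>, of 0 2] assms
    by (simp add: fact_numeral power2_eq_square field_simps)
  finally have i2: "(\<integral>\<omega>. ?X \<omega> ^ 4 \<partial>M) = 3 * (t - r)\<^sup>2" .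
  have [measurable]: "?X \<in> borel_measurable M"
    using W_measurable assms by (intro borel_measurable_diff) auto
  have "prob {\<omega>\<in>space M. \<bar>?X \<omega>\<bar> > e} \<le> prob {\<omega>\<in>space M. ?X \<omega> ^ 4 \<ge> e ^ 4}"
  proof (rule finite_measure_mono)
    show "{\<omega>\<in>space M. \<bar>?X \<omega>\<bar> > e} \<subseteq> {\<omega>\<in>space M. ?X \<omega> ^ 4 \<ge> e ^ 4}"
    proof clarify
      fix \<omega> assume "e < \<bar>?X \<omega>\<bar>"
      then have "e ^ 4 \<le> \<bar>?X \<omega>\<bar> ^ 4" using assms by (intro power_mono) auto
      then show "e ^ 4 \<le> ?X \<omega> ^ 4" by (simp add: power_even_abs)
    qed
  qed measurable
  also have "\<dots> \<le> (\<integral>\<omega>. ?X \<omega> ^ 4 \<partial>M) / e ^ 4"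
    using assms by (intro integral_Markov_inequality_measure[OF i1, where A="space M"]) auto
  finally show ?thesis unfolding i2 .
qed

text \<open>On \<open>[-e, e]\<close> the density is smallest at the endpoints; that value times the
  length \<open>2 * e\<close> is the bound.\<close>

lemma increment_small_ball:
  assumes "0 \<le> r" "r < t" "0 < e"
  shows "prob {\<omega>\<in>space M. \<bar>W t \<omega> - W r \<omega>\<bar> \<le> e}
           \<ge> 2 * e * exp (- e\<^sup>2 / (2 * (t - r))) / sqrt (2 * pi * (t - r))"
proof -
  let ?X = "\<lambda>\<omega>. W t \<omega> - W r \<omega>"
  let ?d = "normal_density 0 (sqrt (t - r))"
  let ?c = "exp (- e\<^sup>2 / (2 * (t - r))) / sqrt (2 * pi * (t - r))"
  note D = W_increment[OF assms(1,2)]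
  have c: "0 \<le> ?c" using assms by simp
  have "ennreal (2 * e * ?c) = (\<integral>\<^sup>+x. ennreal ?c * indicator {-e..e} x \<partial>lborel)"
    using assms c by (subst nn_integral_cmult_indicator) (auto simp: ennreal_mult'[symmetric] mult_ac)
  also have "\<dots> \<le> (\<integral>\<^sup>+x. ennreal (?d x) * indicator {-e..e} x \<partial>lborel)"
  proof (intro nn_integral_mono)
    fix x :: real
    show "ennreal ?c * indicator {-e..e} x \<le> ennreal (?d x) * indicator {-e..e} x"
    proof (cases "x \<in> {-e..e}")
      case True
      then have "x\<^sup>2 \<le> e\<^sup>2" using assms(3) by (auto simp: abs_le_square_iff[symmetric])
      then have "?c \<le> ?d x"
        using assms unfolding normal_density_def
        by (auto simp: divide_simps mult_mono real_sqrt_mult)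
      then show ?thesis using True by (auto intro: ennreal_leI)
    qed auto
  qed
  also have "\<dots> = emeasure M (?X -` {-e..e} \<inter> space M)"
    using distributed_emeasure[OF D, of "{-e..e}"] by simp
  also have "?X -` {-e..e} \<inter> space M = {\<omega>\<in>space M. \<bar>?X \<omega>\<bar> \<le> e}"
    by (auto simp: abs_le_iff)
  finally have "ennreal (2 * e * ?c) \<le> ennreal (prob {\<omega>\<in>space M. \<bar>?X \<omega>\<bar> \<le> e})"
    by (simp add: emeasure_eq_measure)
  then show ?thesis by (simp add: ennreal_le_iff)
qed

section \<open>Path bounds and the maximal inequality\<close>

text \<open>The mesh is left open because three choices occur: \<open>1\<close> for measurability,
  the interval length for chaining, and the block length for independence.\<close>

lemma path_bound_iff_grid:
  assumes \<omega>: "\<omega> \<in> space M" and p: "0 \<le> p" and cont: "continuous_on {p..q} \<beta>" and h: "0 < h"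
  shows "(\<forall>u\<in>{p..q}. \<bar>W u \<omega> - W p \<omega>\<bar> \<le> \<beta> u) \<longleftrightarrow>
    (\<forall>m k. p + real k * h / 2 ^ m \<le> q \<longrightarrow>
      \<bar>W (p + real k * h / 2 ^ m) \<omega> - W p \<omega>\<bar> \<le> \<beta> (p + real k * h / 2 ^ m))"
    (is "?L \<longleftrightarrow> ?R")
proof
  assume ?L then show ?R using h by auto
next
  assume R: ?R
  have "continuous_on {p..q} (\<lambda>u. W u \<omega>)"
    by (rule continuous_on_subset[OF W_continuous[OF \<omega>]]) (use p in auto)
  then have c: "continuous_on {p..q} (\<lambda>u. \<bar>W u \<omega> - W p \<omega>\<bar> - \<beta> u)"
    using cont by (intro continuous_intros)
  show ?L using continuous_on_le_from_dyadic_grid[OF c h] R by force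
qed

lemma path_bound_measurable:
  assumes p: "0 \<le> p" and cont: "continuous_on {p..q} \<beta>"
  shows "{\<omega>\<in>space M. \<forall>u\<in>{p..q}. \<bar>W u \<omega> - W p \<omega>\<bar> \<le> \<beta> u} \<in> sets M"
proof -
  have [measurable]: "W p \<in> borel_measurable M" "\<And>m k. W (p + real k * 1 / 2 ^ m) \<in> borel_measurable M"
    using p by (auto intro!: W_measurable)
  have "{\<omega>\<in>space M. \<forall>u\<in>{p..q}. \<bar>W u \<omega> - W p \<omega>\<bar> \<le> \<beta> u} =
    {\<omega>\<in>space M. \<forall>m k. p + real k * 1 / 2 ^ m \<le> q \<longrightarrow>
      \<bar>W (p + real k * 1 / 2 ^ m) \<omega> - W p \<omega>\<bar> \<le> \<beta> (p + real k * 1 / 2 ^ m)}"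
    using path_bound_iff_grid[OF _ p cont, of _ 1] by auto
  also have "\<dots> \<in> sets M" by measurable
  finally show ?thesis .
qed

text \<open>Chaining with the weights \<open>(9/10) ^ l / 10\<close>: by the fourth moment bound the
  contributions of the dyadic levels decay like \<open>(2 * (9/10) ^ 4) powi (- l)\<close>, and
  \<open>2 * (9/10) ^ 4 > 1\<close>.\<close>
lemma maximal_inequality:
  assumes r: "0 \<le> r" and L: "0 < L" and e: "0 < e"
  shows "prob {\<omega>\<in>space M. \<forall>u\<in>{r..r+L}. \<bar>W u \<omega> - W r \<omega>\<bar> \<le> e} \<ge> 1 - 150000 * L\<^sup>2 / e ^ 4"
proof -
  define c where "c l = e * ((9/10) ^ l / 10)" for l :: nat
  define t where "t l j = r + real j * L / 2 ^ l" for l j :: nat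
  define A where "A l j = {\<omega>\<in>space M. \<bar>W (t l (Suc j)) \<omega> - W (t l j) \<omega>\<bar> > c l}" for l j
  define B where "B l = (\<Union>j<2 ^ l. A l j)" for l
  \<comment> \<open>Equal to \<open>1 / (2 * (9/10) ^ 4)\<close>, the ratio of the bounds for
    consecutive levels.\<close>
  define x :: real where "x = 10000 / 13122"
  let ?G = "{\<omega>\<in>space M. \<forall>u\<in>{r..r+L}. \<bar>W u \<omega> - W r \<omega>\<bar> \<le> e}"
  have c: "0 < c l" for l using e by (simp add: c_def)
  have t: "0 \<le> t l j" "t l j < t l (Suc j)" "t l (Suc j) - t l j = L / 2 ^ l" for l j
    using r L by (auto simp: t_def field_simps)
  have [measurable]: "W (t l j) \<in> borel_measurable M" for l j
    using t by (intro W_measurable) auto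
  have A_sets: "A l j \<in> events" for l j unfolding A_def by measurable
  then have B_sets: "B l \<in> events" for l unfolding B_def by auto
  have B_le: "prob (B l) \<le> 30000 * L\<^sup>2 / e ^ 4 * x ^ l" for l
  proof -
    have "prob (B l) \<le> (\<Sum>j<2 ^ l. prob (A l j))"
      unfolding B_def using A_sets by (intro finite_measure_subadditive_finite) auto
    also have "\<dots> \<le> (\<Sum>j<(2::nat) ^ l. 3 * (L / 2 ^ l)\<^sup>2 / c l ^ 4)"
      unfolding A_def using increment_tail[OF t(1,2) c] by (intro sum_mono) (simp add: t(3))
    also have "\<dots> = 2 ^ l * (3 * (L / 2 ^ l)\<^sup>2 / c l ^ 4)" by simp
    \<comment> \<open>The factor \<open>30000\<close> is the \<open>3\<close> of
      \<open>increment_tail\<close> times the fourth power of the \<open>10\<close> in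
      \<open>c\<close>.\<close>
    also have "\<dots> = 30000 * L\<^sup>2 / e ^ 4 * (1 / (2 * (9/10) ^ 4)) ^ l"
    proof -
      define y :: real where "y = (9/10) ^ 4"
      have y: "y > 0" by (simp add: y_def)
      have "((9/10::real) ^ l) ^ 4 = y ^ l"
        unfolding y_def power_mult[symmetric] by (simp only: mult.commute)
      then have c4: "c l ^ 4 = e ^ 4 / 10000 * y ^ l"
        unfolding c_def power_mult_distrib power_divide[of "(9/10::real) ^ l"] by simp
      show ?thesis
        using e y unfolding y_def[symmetric] c4
        by (simp add: power_mult_distrib power_divide power2_eq_square field_simps)
    qed
    also have "1 / (2 * (9/10) ^ 4) = x" by (simp add: x_def power_divide)
    finally show ?thesis .
  qed
  have sx: "summable (\<lambda>l. 30000 * L\<^sup>2 / e ^ 4 * x ^ l)"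
    by (intro summable_mult summable_geometric) (simp add: x_def)
  have sB: "summable (\<lambda>l. prob (B l))"
    by (rule summable_comparison_test'[OF sx]) (use B_le in auto)
  have "prob (\<Union>l. B l) \<le> (\<Sum>l. prob (B l))"
    using B_sets sB by (intro finite_measure_subadditive_countably) auto
  also have "\<dots> \<le> (\<Sum>l. 30000 * L\<^sup>2 / e ^ 4 * x ^ l)"
    by (intro suminf_le B_le sB sx)
  also have "\<dots> = 30000 * L\<^sup>2 / e ^ 4 * (1 / (1 - x))"
    by (subst suminf_mult) (auto simp: suminf_geometric x_def)
  also have "\<dots> \<le> 150000 * L\<^sup>2 / e ^ 4"
  proof -
    \<comment> \<open>The exact value is \<open>13122 / 3122\<close>; rounding it up to
      \<open>5\<close> turns \<open>30000\<close> into \<open>150000\<close>.\<close>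
    have "1 / (1 - x) \<le> 5" by (simp add: x_def)
    then have "30000 * L\<^sup>2 / e ^ 4 * (1 / (1 - x)) \<le> 30000 * L\<^sup>2 / e ^ 4 * 5"
      by (intro mult_left_mono) auto
    then show ?thesis by simp
  qed
  finally have bad: "prob (\<Union>l. B l) \<le> 150000 * L\<^sup>2 / e ^ 4" .
  have G_sets: "?G \<in> events"
    by (intro path_bound_measurable r continuous_intros)
  have "space M - (\<Union>l. B l) \<subseteq> ?G"
  proof
    fix \<omega> assume \<omega>: "\<omega> \<in> space M - (\<Union>l. B l)"
    have inc: "\<bar>W (r + (real j + 1) * L / 2 ^ l) \<omega> - W (r + real j * L / 2 ^ l) \<omega>\<bar> \<le> c l"
      if "j < 2 ^ l" for l j
      using \<omega> that by (force simp: B_def A_def t_def add.commute)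
    \<comment> \<open>The weights form a geometric series with total \<open>1\<close>, so no partial
      sum exceeds \<open>e\<close>.\<close>
    have sum_c: "(\<Sum>l\<le>m. c l) \<le> e" for m
    proof -
      have "(\<Sum>l\<le>m. c l) = e / 10 * (\<Sum>l\<le>m. (9/10) ^ l)"
        by (simp add: c_def sum_distrib_left)
      also have "\<dots> = e * (1 - (9/10) ^ Suc m)"
        by (subst sum_gp0) simp
      also have "\<dots> \<le> e" using e by (simp add: mult_le_cancel_left1)
      finally show ?thesis .
    qed
    have "\<bar>W (r + real k * L / 2 ^ m) \<omega> - W r \<omega>\<bar> \<le> e" if "r + real k * L / 2 ^ m \<le> r + L" for m k
    proof -
      have "real k \<le> 2 ^ m" using that L by (simp add: field_simps)
      then have "k \<le> 2 ^ m" by (metis of_nat_le_iff of_nat_numeral of_nat_power)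
      from dyadic_chaining[of "\<lambda>u. W u \<omega>", OF inc this] sum_c[of m] show ?thesis by simp
    qed
    then show "\<omega> \<in> ?G"
      using path_bound_iff_grid[of \<omega> r "r + L" "\<lambda>_. e" L] \<omega> r L by auto
  qed
  then have "prob (space M - (\<Union>l. B l)) \<le> prob ?G"
    using G_sets by (rule finite_measure_mono)
  then show ?thesis using bad prob_compl[of "\<Union>l. B l"] B_sets by auto
qed

section \<open>Independence over consecutive blocks\<close>

lemma increments_indep:
  assumes d: "0 < d"
  shows "indep_vars (\<lambda>_. borel) (\<lambda>k \<omega>. W (real (Suc k) * d) \<omega> - W (real k * d) \<omega>) {..<n}"
proof -
  have "\<forall>(n::nat) (ts::nat \<Rightarrow> real). 0 \<le> ts 0 \<and> (\<forall>i<n. ts i < ts (Suc i)) \<longrightarrow>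
        indep_vars (\<lambda>_. borel) (\<lambda>i \<omega>. W (ts (Suc i)) \<omega> - W (ts i) \<omega>) {..<n}"
    using brownian by (simp add: brownian_motion_def)
  from this[rule_format, of "\<lambda>k. real k * d" n] show ?thesis
    using d by auto
qed

text \<open>The event of block \<open>i\<close> depends only on the elementary increments with index
  in \<open>{a i..<a (Suc i)}\<close>. These index sets are disjoint, so grouping independent
  increments yields independent blocks.\<close>

lemma grid_blocks_indep:
  assumes d: "0 < d" and a: "\<And>i. i < n \<Longrightarrow> a i \<le> a (Suc i)" and n: "0 < n"
  shows "prob {\<omega>\<in>space M. \<forall>i<n. \<forall>k\<in>{a i..a (Suc i)}. \<bar>W (real k * d) \<omega> - W (real (a i) * d) \<omega>\<bar> \<le> \<beta> i k}
    = (\<Prod>i<n. prob {\<omega>\<in>space M. \<forall>k\<in>{a i..a (Suc i)}. \<bar>W (real k * d) \<omega> - W (real (a i) * d) \<omega>\<bar> \<le> \<beta> i k})"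
proof -
  define D where "D k \<omega> = W (real (Suc k) * d) \<omega> - W (real k * d) \<omega>" for k \<omega>
  define K where "K i = {a i..<a (Suc i)}" for i
  \<comment> \<open>The block event as a set of increment tuples: a displacement from the start of
    the block is a telescoping partial sum.\<close>
  define S where "S i = {f \<in> space (PiM (K i) (\<lambda>_. borel :: real measure)).
    \<forall>k\<in>{a i..a (Suc i)}. \<bar>\<Sum>l\<in>{a i..<k}. f l\<bar> \<le> \<beta> i k}" for i
  let ?X = "\<lambda>i \<omega>. restrict (\<lambda>l. D l \<omega>) (K i)"
  have mono: "a i \<le> a j" if "i \<le> j" "j \<le> n" for i j
    using that
  proof (induction j)
    case (Suc j)
    then show ?case using a[of j] by (cases "i = Suc j") auto
  qed simp
  have K_sub: "K i \<subseteq> {..<a n}" if "i < n" for i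
    using mono[of "Suc i" n] that by (auto simp: K_def)
  have disj: "disjoint_family_on K {..<n}"
    unfolding disjoint_family_on_def
  proof safe
    fix i j l assume ij: "i < n" "j < n" "i \<noteq> j" and l: "l \<in> K i" "l \<in> K j"
    then consider "i < j" | "j < i" by linarith
    then show "l \<in> {}"
      using mono[of "Suc i" j] mono[of "Suc j" i] ij l by cases (auto simp: K_def)
  qed
  have "indep_vars (\<lambda>_. borel) D {..<a n}"
    using increments_indep[OF d, of "a n"] unfolding D_def .
  from indep_vars_restrict[OF this, of "{..<n}" K]
  have ind: "indep_vars (\<lambda>i. PiM (K i) (\<lambda>_. borel)) ?X {..<n}"
    using K_sub disj by auto
  have S_sets: "S i \<in> sets (PiM (K i) (\<lambda>_. borel))" for i
  proof -
    have [measurable]: "(\<lambda>f. \<Sum>l\<in>{a i..<k}. f l) \<in> borel_measurable (PiM (K i) (\<lambda>_. borel :: real measure))"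
      if "k \<in> {a i..a (Suc i)}" for k
      using that by (intro borel_measurable_sum measurable_component_singleton) (auto simp: K_def)
    show ?thesis unfolding S_def by measurable
  qed
  have tele: "(\<Sum>l\<in>{a i..<k}. D l \<omega>) = W (real k * d) \<omega> - W (real (a i) * d) \<omega>" if "a i \<le> k" for i k \<omega>
    unfolding D_def using that by (rule sum_Suc_diff')
  have vimage: "?X i -` S i \<inter> space M =
    {\<omega>\<in>space M. \<forall>k\<in>{a i..a (Suc i)}. \<bar>W (real k * d) \<omega> - W (real (a i) * d) \<omega>\<bar> \<le> \<beta> i k}" for i
  proof -
    have "(\<Sum>l\<in>{a i..<k}. ?X i \<omega> l) = W (real k * d) \<omega> - W (real (a i) * d) \<omega>"
      if "k \<in> {a i..a (Suc i)}" for k \<omega>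
    proof -
      have "(\<Sum>l\<in>{a i..<k}. ?X i \<omega> l) = (\<Sum>l\<in>{a i..<k}. D l \<omega>)"
        using that by (intro sum.cong) (auto simp: K_def)
      then show ?thesis using tele that by simp
    qed
    then show ?thesis by (auto simp: S_def space_PiM)
  qed
  have "prob (\<Inter>i\<in>{..<n}. ?X i -` S i \<inter> space M) = (\<Prod>i\<in>{..<n}. prob (?X i -` S i \<inter> space M))"
    using n S_sets by (intro indep_varsD[OF ind]) auto
  moreover have "(\<Inter>i\<in>{..<n}. ?X i -` S i \<inter> space M) =
    {\<omega>\<in>space M. \<forall>i<n. \<forall>k\<in>{a i..a (Suc i)}. \<bar>W (real k * d) \<omega> - W (real (a i) * d) \<omega>\<bar> \<le> \<beta> i k}"
    unfolding vimage using n by auto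
  ultimately show ?thesis unfolding vimage by simp
qed

text \<open>The continuous-time event is the limit of the decreasing grid events \<open>G m\<close>.
  Each \<open>G m\<close> has product probability by \<open>grid_blocks_indep\<close>, and each of
  its factors is at least \<open>prob (E i)\<close>, so the bound survives the limit.\<close>

lemma path_blocks_prob_ge:
  fixes a :: "nat \<Rightarrow> nat" and \<beta> :: "nat \<Rightarrow> real \<Rightarrow> real" and \<eta> :: "nat \<Rightarrow> real"
  assumes h: "0 < h" and a: "\<And>i. i < n \<Longrightarrow> a i \<le> a (Suc i)" and n: "0 < n"
    and cont: "\<And>i. i < n \<Longrightarrow> continuous_on {real (a i) * h..real (a (Suc i)) * h} (\<beta> i)"
  defines "E \<equiv> \<lambda>i. {\<omega>\<in>space M. (\<forall>u\<in>{real (a i) * h..real (a (Suc i)) * h}.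
      \<bar>W u \<omega> - W (real (a i) * h) \<omega>\<bar> \<le> \<beta> i u) \<and>
      \<bar>W (real (a (Suc i)) * h) \<omega> - W (real (a i) * h) \<omega>\<bar> \<le> \<eta> i}"
  shows "prob {\<omega>\<in>space M. \<forall>i<n. \<omega> \<in> E i} \<ge> (\<Prod>i<n. prob (E i))"
proof -
  define d where "d m = h / 2 ^ m" for m :: nat
  \<comment> \<open>The extra constraint \<open>\<eta> i\<close> on the total increment is folded
    into the bound at the last index of the block, which gives the event the shape required by
    \<open>grid_blocks_indep\<close>.\<close>
  define b where "b m i k = (if k = a (Suc i) * 2 ^ m then min (\<eta> i) (\<beta> i (real k * d m)) else \<beta> i (real k * d m))"
    for m i k :: nat
  define F where "F m i = {\<omega>\<in>space M. \<forall>k\<in>{a i * 2 ^ m..a (Suc i) * 2 ^ m}.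
    \<bar>W (real k * d m) \<omega> - W (real (a i * 2 ^ m) * d m) \<omega>\<bar> \<le> b m i k}" for m i
  define G where "G m = {\<omega>\<in>space M. \<forall>i<n. \<omega> \<in> F m i}" for m
  have d: "0 < d m" for m using h by (simp add: d_def)
  \<comment> \<open>Block ends are grid points of every level, so refining the grid does not move
    them.\<close>
  have scale: "real (j * 2 ^ m) * d m = real j * h" for j m by (simp add: d_def)
  have [measurable]: "W (real k * d m) \<in> borel_measurable M" for k m
    using d[of m] by (intro W_measurable) auto
  have F_sets: "F m i \<in> events" for m i unfolding F_def by measurable
  then have G_sets: "G m \<in> events" for m unfolding G_def by measurable
  have F_iff: "\<omega> \<in> F m i \<longleftrightarrow> \<omega> \<in> space M \<and>
      (\<forall>k\<in>{a i * 2 ^ m..a (Suc i) * 2 ^ m}.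
        \<bar>W (real k * d m) \<omega> - W (real (a i) * h) \<omega>\<bar> \<le> \<beta> i (real k * d m)) \<and>
      \<bar>W (real (a (Suc i)) * h) \<omega> - W (real (a i) * h) \<omega>\<bar> \<le> \<eta> i" if "i < n" for m i \<omega>
  proof -
    have K: "a (Suc i) * 2 ^ m \<in> {a i * 2 ^ m..a (Suc i) * 2 ^ m}" using a[OF that] by simp
    have min_end: "(\<forall>k\<in>S. x k \<le> (if k = l then min e (y k) else y k)) \<longleftrightarrow> (\<forall>k\<in>S. x k \<le> y k) \<and> x l \<le> e"
      if "l \<in> S" for S and l :: nat and x y :: "nat \<Rightarrow> real" and e
      using that by auto
    show ?thesis
      unfolding F_def b_def scale mem_Collect_eq min_end[OF K] ..
  qed
  have E_sub: "E i \<subseteq> F m i" if i: "i < n" for m i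
  proof
    fix \<omega> assume \<omega>: "\<omega> \<in> E i"
    have "real k * d m \<in> {real (a i) * h..real (a (Suc i)) * h}"
      if "k \<in> {a i * 2 ^ m..a (Suc i) * 2 ^ m}" for k
      using that d[of m] unfolding scale[symmetric, of _ m] atLeastAtMost_iff
      by (simp only: mult_le_cancel_right_pos of_nat_le_iff)
    then show "\<omega> \<in> F m i" using \<omega> by (simp add: F_iff[OF i] E_def)
  qed
  have "(\<Prod>i<n. prob (E i)) \<le> (\<Prod>i<n. prob (F m i))" for m
    using E_sub F_sets by (intro prod_mono conjI measure_nonneg finite_measure_mono) auto
  also have "(\<Prod>i<n. prob (F m i)) = prob (G m)" for m
  proof -
    have "prob (G m) = prob {\<omega>\<in>space M. \<forall>i<n. \<forall>k\<in>{a i * 2 ^ m..a (Suc i) * 2 ^ m}.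
      \<bar>W (real k * d m) \<omega> - W (real (a i * 2 ^ m) * d m) \<omega>\<bar> \<le> b m i k}"
      using n by (intro arg_cong[where f=prob]) (auto simp: G_def F_def)
    also have "\<dots> = (\<Prod>i<n. prob (F m i))"
      unfolding F_def using a n by (intro grid_blocks_indep d) auto
    finally show ?thesis by simp
  qed
  finally have G_ge: "(\<Prod>i<n. prob (E i)) \<le> prob (G m)" for m .
  \<comment> \<open>Point \<open>k\<close> of level \<open>m\<close> is point \<open>2 * k\<close>
    of level \<open>m + 1\<close>, so finer grids impose more constraints.\<close>
  have "decseq G"
  proof (rule decseq_SucI)
    fix m
    show "G (Suc m) \<subseteq> G m"
    proof
      fix \<omega> assume \<omega>: "\<omega> \<in> G (Suc m)"
      have "\<omega> \<in> F m i" if i: "i < n" for i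
      proof -
        have "\<omega> \<in> F (Suc m) i" using \<omega> i by (simp add: G_def)
        note * = this[unfolded F_iff[OF i]]
        have "\<bar>W (real k * d m) \<omega> - W (real (a i) * h) \<omega>\<bar> \<le> \<beta> i (real k * d m)"
          if "k \<in> {a i * 2 ^ m..a (Suc i) * 2 ^ m}" for k
        proof -
          have "real (2 * k) * d (Suc m) = real k * d m" by (simp add: d_def)
          moreover have "2 * k \<in> {a i * 2 ^ Suc m..a (Suc i) * 2 ^ Suc m}" using that by simp
          moreover have "\<bar>W (real j * d (Suc m)) \<omega> - W (real (a i) * h) \<omega>\<bar> \<le> \<beta> i (real j * d (Suc m))"
            if "j \<in> {a i * 2 ^ Suc m..a (Suc i) * 2 ^ Suc m}" for j
            using * that by blast
          ultimately show ?thesis by metis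
        qed
        then show ?thesis using * F_iff[OF i] by blast
      qed
      then show "\<omega> \<in> G m" using \<omega> by (simp add: G_def)
    qed
  qed
  then have "(\<lambda>m. prob (G m)) \<longlonglongrightarrow> prob (\<Inter>m. G m)"
    using G_sets by (intro finite_Lim_measure_decseq) auto
  then have "(\<Prod>i<n. prob (E i)) \<le> prob (\<Inter>m. G m)"
    by (rule LIMSEQ_le_const) (use G_ge in auto)
  also have "(\<Inter>m. G m) = {\<omega>\<in>space M. \<forall>i<n. \<omega> \<in> E i}"
  proof (intro equalityI subsetI)
    fix \<omega> assume \<omega>: "\<omega> \<in> (\<Inter>m. G m)"
    then have sp: "\<omega> \<in> space M" and all: "\<omega> \<in> F m i" if "i < n" for i m
      using that by (auto simp: G_def)
    have "\<omega> \<in> E i" if i: "i < n" for i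
    proof -
      let ?p = "real (a i) * h"
      have "\<bar>W (?p + real k * h / 2 ^ m) \<omega> - W ?p \<omega>\<bar> \<le> \<beta> i (?p + real k * h / 2 ^ m)"
        if k: "?p + real k * h / 2 ^ m \<le> real (a (Suc i)) * h" for k m
      proof -
        have eq: "?p + real k * h / 2 ^ m = real (a i * 2 ^ m + k) * d m"
          by (simp add: d_def field_simps)
        have "real (a i * 2 ^ m + k) * d m \<le> real (a (Suc i) * 2 ^ m) * d m"
          using k unfolding eq scale .
        then have "a i * 2 ^ m + k \<le> a (Suc i) * 2 ^ m"
          using d[of m] by (simp only: mult_le_cancel_right_pos of_nat_le_iff)
        then have "a i * 2 ^ m + k \<in> {a i * 2 ^ m..a (Suc i) * 2 ^ m}" by simp
        then show ?thesis
          unfolding eq using all[OF i, of m, unfolded F_iff[OF i]] by blast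
      qed
      then have "\<forall>u\<in>{?p..real (a (Suc i)) * h}. \<bar>W u \<omega> - W ?p \<omega>\<bar> \<le> \<beta> i u"
        using path_bound_iff_grid[of \<omega> ?p "real (a (Suc i)) * h" "\<beta> i" h] sp[OF i] cont[OF i] h by auto
      \<comment> \<open>The constraint on the total increment is the same at all levels, so level
        \<open>0\<close> supplies it.\<close>
      then show ?thesis using sp[OF i] all[OF i, of 0] by (simp add: E_def F_iff[OF i])
    qed
    then show "\<omega> \<in> {\<omega>\<in>space M. \<forall>i<n. \<omega> \<in> E i}" using sp n by auto
  next
    fix \<omega> assume "\<omega> \<in> {\<omega>\<in>space M. \<forall>i<n. \<omega> \<in> E i}"
    then show "\<omega> \<in> (\<Inter>m. G m)" using E_sub by (auto simp: G_def)
  qed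
  finally show ?thesis .
qed

section \<open>Staying inside the boundary with positive probability\<close>

text \<open>The increment constraint has probability at least \<open>A / N\<close>, while the
  oscillation constraint fails with probability at most \<open>B / N / N\<close>; hence
  \<open>N > B / A\<close> leaves positive probability for both together. The estimates depend on
  the block length only, so one \<open>N\<close> serves every block.\<close>

lemma small_block_prob_pos:
  assumes T: "0 < T" and e: "0 < e"
  obtains N :: nat where "0 < N"
    and "\<And>i :: nat. 0 < prob {\<omega>\<in>space M.
      (\<forall>u\<in>{real i * (T / N)..real (Suc i) * (T / N)}. \<bar>W u \<omega> - W (real i * (T / N)) \<omega>\<bar> \<le> e) \<and>
      \<bar>W (real (Suc i) * (T / N)) \<omega> - W (real i * (T / N)) \<omega>\<bar> \<le> e / N}"
proof -
  \<comment> \<open>\<open>A\<close> is the small ball bound for radius \<open>e\<close> and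
    duration \<open>T\<close>, and \<open>B\<close> the maximal inequality bound for the same
    data.\<close>
  define A where "A = 2 * e * exp (- e\<^sup>2 / (2 * T)) / sqrt (2 * pi * T)"
  define B where "B = 150000 * T\<^sup>2 / e ^ 4"
  have A: "0 < A" using T e by (simp add: A_def)
  obtain N0 :: nat where N0: "B / A < real N0" using reals_Archimedean2 by blast
  define N where "N = max N0 1"
  have N: "0 < N" "1 \<le> real N" "B / A < real N" using N0 by (auto simp: N_def)
  define h where "h = T / real N"
  have h: "0 < h" using T N by (simp add: h_def)
  have "0 < prob {\<omega>\<in>space M. (\<forall>u\<in>{real i * h..real (Suc i) * h}. \<bar>W u \<omega> - W (real i * h) \<omega>\<bar> \<le> e) \<and>
      \<bar>W (real (Suc i) * h) \<omega> - W (real i * h) \<omega>\<bar> \<le> e / N}" (is "0 < prob ?E") for i :: nat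
  proof -
    let ?r = "real i * h" and ?t = "real (Suc i) * h"
    have r: "0 \<le> ?r" "?r < ?t" "?t - ?r = h" "?t = ?r + h" using h by (auto simp: algebra_simps)
    let ?S = "{\<omega>\<in>space M. \<bar>W ?t \<omega> - W ?r \<omega>\<bar> \<le> e / N}"
    let ?P = "{\<omega>\<in>space M. \<forall>u\<in>{?r..?t}. \<bar>W u \<omega> - W ?r \<omega>\<bar> \<le> e}"
    have [measurable]: "W ?t \<in> borel_measurable M" "W ?r \<in> borel_measurable M"
      using r by (auto intro!: W_measurable)
    have S: "?S \<in> events" by measurable
    have P: "?P \<in> events" by (intro path_bound_measurable r continuous_intros)
    \<comment> \<open>Passing to radius \<open>e / N\<close> and duration \<open>T / N\<close> makes
      the exponent smaller and the square root no larger. The gain from the square root is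
      discarded: \<open>A / N\<close> already beats \<open>B / N / N\<close>.\<close>
    have "A / N \<le> 2 * (e / N) * exp (- (e / N)\<^sup>2 / (2 * h)) / sqrt (2 * pi * h)"
    proof -
      have "(e / N)\<^sup>2 / (2 * h) = e\<^sup>2 / (2 * T) / N"
        using N T by (simp add: h_def power2_eq_square field_simps)
      also have "\<dots> \<le> e\<^sup>2 / (2 * T) / 1"
        using N T e by (intro divide_left_mono) auto
      finally have "exp (- e\<^sup>2 / (2 * T)) \<le> exp (- (e / N)\<^sup>2 / (2 * h))" by simp
      moreover have "h \<le> T / 1" unfolding h_def using N T by (intro divide_left_mono) auto
      then have "sqrt (2 * pi * h) \<le> sqrt (2 * pi * T)" by simp
      ultimately have "2 * (e / N) * exp (- e\<^sup>2 / (2 * T)) / sqrt (2 * pi * T)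
        \<le> 2 * (e / N) * exp (- (e / N)\<^sup>2 / (2 * h)) / sqrt (2 * pi * h)"
        using e h N by (intro frac_le mult_left_mono mult_nonneg_nonneg) auto
      then show ?thesis by (simp add: A_def field_simps)
    qed
    also have "\<dots> \<le> prob ?S"
      using increment_small_ball[of ?r ?t "e / N", unfolded r(3)] r e N by simp
    finally have S_ge: "A / N \<le> prob ?S" .
    have "prob (space M - ?P) \<le> 150000 * h\<^sup>2 / e ^ 4"
      unfolding prob_compl[OF P] using maximal_inequality[OF r(1) h e, folded r(4)] by linarith
    also have "\<dots> = B / N / N" by (simp add: B_def h_def power2_eq_square)
    also have "\<dots> < A / N"
      using N A by (intro divide_strict_right_mono) (auto simp: field_simps)
    finally have bad: "prob (space M - ?P) < A / N" .
    \<comment> \<open>A path with a small total increment either lies in the wanted event or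
      violates the oscillation bound.\<close>
    have "prob ?S \<le> prob (?E \<union> (space M - ?P))"
      using S P by (intro finite_measure_mono) (auto intro: sets.Int[of ?P M ?S, simplified Int_def])
    also have "\<dots> \<le> prob ?E + prob (space M - ?P)"
    proof (intro measure_Un_le)
      have "?E = ?P \<inter> ?S" by auto
      then show "?E \<in> events" using S P by simp
    qed (use P in auto)
    finally show ?thesis using S_ge bad by linarith
  qed
  then show thesis using that N(1) unfolding h_def by blast
qed

text \<open>On a window of length \<open>L\<close> the maximal inequality with threshold
  \<open>c * L powr \<kappa>\<close> fails with probability at most
  \<open>C * L powr (2 - 4 * \<kappa>)\<close>. The exponent is negative, so the sum over
  \<open>L = T * 2 ^ k\<close> converges and tends to \<open>0\<close> as \<open>T\<close> grows.
  \<open>T0\<close> does not depend on the horizon \<open>V\<close>.\<close>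

lemma late_increments_prob_ge:
  assumes \<kappa>: "1/2 < \<kappa>"
  obtains T0 where "0 < T0"
    and "\<And>T V. T0 \<le> T \<Longrightarrow> 1/2 \<le> prob {\<omega>\<in>space M. \<forall>u\<in>{T..V}. \<bar>W u \<omega> - W T \<omega>\<bar> \<le> u powr \<kappa> / 2}"
proof -
  \<comment> \<open>Chosen so that \<open>c * (2 * u) powr \<kappa>\<close> is
    \<open>u powr \<kappa> / 2\<close>; the smallest window reaching \<open>u\<close> has length at
    most \<open>2 * u\<close>.\<close>
  define c :: real where "c = 2 powr (- \<kappa>) / 2"
  \<comment> \<open>Ratio of the failure bounds of consecutive windows.\<close>
  define y :: real where "y = 2 powr (2 - 4 * \<kappa>)"
  define C where "C = 150000 / c ^ 4"
  have c: "0 < c" by (simp add: c_def)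
  have y: "0 < y" "y < 1" using \<kappa> powr_less_mono[of "2 - 4 * \<kappa>" 0 2] by (auto simp: y_def)
  have "((\<lambda>T::real. C / (1 - y) * T powr (2 - 4 * \<kappa>)) \<longlongrightarrow> C / (1 - y) * 0) at_top"
    using \<kappa> by (intro tendsto_intros tendsto_neg_powr filterlim_ident) auto
  then have "\<forall>\<^sub>F T in at_top. C / (1 - y) * T powr (2 - 4 * \<kappa>) < 1/2"
    by (rule order_tendstoD) auto
  then obtain T1 where T1: "\<And>T. T1 \<le> T \<Longrightarrow> C / (1 - y) * T powr (2 - 4 * \<kappa>) < 1/2"
    by (auto simp: eventually_at_top_linorder)
  have "1/2 \<le> prob {\<omega>\<in>space M. \<forall>u\<in>{T..V}. \<bar>W u \<omega> - W T \<omega>\<bar> \<le> u powr \<kappa> / 2}" (is "_ \<le> prob ?G")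
    if "max T1 1 \<le> T" for T V
  proof -
    have T: "0 < T" "T1 \<le> T" using that by auto
    define B where "B k = space M -
      {\<omega>\<in>space M. \<forall>u\<in>{T..T + T * 2 ^ k}. \<bar>W u \<omega> - W T \<omega>\<bar> \<le> c * (T * 2 ^ k) powr \<kappa>}" for k :: nat
    have P: "{\<omega>\<in>space M. \<forall>u\<in>{T..T + T * 2 ^ k}. \<bar>W u \<omega> - W T \<omega>\<bar> \<le> c * (T * 2 ^ k) powr \<kappa>} \<in> events" for k :: nat
      using T by (intro path_bound_measurable continuous_intros) auto
    then have B_sets: "B k \<in> events" for k unfolding B_def by auto
    have B_le: "prob (B k) \<le> C * T powr (2 - 4 * \<kappa>) * y ^ k" for k
    proof -
      define L where "L = T * 2 ^ k"
      have L: "0 < L" using T by (simp add: L_def)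
      have "prob (B k) \<le> 150000 * L\<^sup>2 / (c * L powr \<kappa>) ^ 4"
        unfolding B_def using prob_compl[OF P[of k]] maximal_inequality[of T L "c * L powr \<kappa>"] T L c
        by (simp add: L_def)
      also have "\<dots> = C * (L powr 2 / L powr (4 * \<kappa>))"
        using L by (simp add: C_def power_mult_distrib powr_power mult.commute)
      also have "\<dots> = C * L powr (2 - 4 * \<kappa>)" by (simp only: powr_diff)
      also have "L powr (2 - 4 * \<kappa>) = T powr (2 - 4 * \<kappa>) * y ^ k"
        using T by (simp add: L_def y_def powr_mult powr_powr mult.commute flip: powr_realpow)
      finally show ?thesis by (simp add: mult.assoc)
    qed
    have sx: "summable (\<lambda>k. C * T powr (2 - 4 * \<kappa>) * y ^ k)"
      using y by (intro summable_mult summable_geometric) auto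
    have sB: "summable (\<lambda>k. prob (B k))"
      by (rule summable_comparison_test'[OF sx]) (use B_le in auto)
    have "prob (\<Union>k. B k) \<le> (\<Sum>k. prob (B k))"
      using B_sets sB by (intro finite_measure_subadditive_countably) auto
    also have "\<dots> \<le> (\<Sum>k. C * T powr (2 - 4 * \<kappa>) * y ^ k)"
      by (intro suminf_le B_le sB sx)
    also have "\<dots> = C / (1 - y) * T powr (2 - 4 * \<kappa>)"
      using y by (subst suminf_mult) (auto simp: suminf_geometric)
    also have "\<dots> < 1/2" using T1 T by auto
    finally have bad: "prob (\<Union>k. B k) < 1/2" .
    have G: "?G \<in> events"
      using T by (intro path_bound_measurable continuous_intros) auto
    have "space M - (\<Union>k. B k) \<subseteq> ?G"
    proof
      fix \<omega> assume \<omega>: "\<omega> \<in> space M - (\<Union>k. B k)"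
      have "\<forall>u\<in>{T..V}. \<bar>W u \<omega> - W T \<omega>\<bar> \<le> u powr \<kappa> / 2"
      proof
        fix u assume u: "u \<in> {T..V}"
        have "\<exists>k. u - T \<le> T * 2 ^ k"
        proof -
          obtain k where "(u - T) / T < 2 ^ k" using real_arch_pow[of 2 "(u - T) / T"] by auto
          then show ?thesis using T by (intro exI[of _ k]) (simp add: field_simps)
        qed
        \<comment> \<open>Minimality gives \<open>T * 2 ^ (k - 1) < u - T\<close> when
          \<open>k > 0\<close>; when \<open>k = 0\<close> the length \<open>T\<close> is itself at
          most \<open>u\<close>.\<close>
        define k where "k = (LEAST k. u - T \<le> T * 2 ^ k)"
        have k: "u - T \<le> T * 2 ^ k" unfolding k_def by (rule LeastI_ex) fact
        have k2: "T * 2 ^ k \<le> 2 * u"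
        proof (cases k)
          case 0
          then show ?thesis using u T by simp
        next
          case (Suc j)
          then have "\<not> u - T \<le> T * 2 ^ j" using not_less_Least[of j "\<lambda>k. u - T \<le> T * 2 ^ k"] by (simp add: k_def)
          then show ?thesis using Suc T by simp
        qed
        have "\<bar>W u \<omega> - W T \<omega>\<bar> \<le> c * (T * 2 ^ k) powr \<kappa>"
          using \<omega> k u by (auto simp: B_def)
        also have "\<dots> \<le> c * (2 * u) powr \<kappa>"
          using k2 c \<kappa> T by (intro mult_left_mono powr_mono2) auto
        also have "\<dots> = u powr \<kappa> / 2"
          using u T by (simp add: c_def powr_mult powr_minus)
        finally show "\<bar>W u \<omega> - W T \<omega>\<bar> \<le> u powr \<kappa> / 2" .
      qed
      then show "\<omega> \<in> ?G" using \<omega> by simp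
    qed
    then have "prob (space M - (\<Union>k. B k)) \<le> prob ?G"
      using G by (rule finite_measure_mono)
    then show ?thesis using bad prob_compl[of "\<Union>k. B k"] B_sets by auto
  qed
  then show thesis using that[of "max T1 1"] by auto
qed

text \<open>The constant is fixed before the horizon \<open>V\<close>, and one event serves all
  starting points \<open>y\<close> at once. It consists of \<open>N\<close> short blocks up to
  \<open>T\<close> followed by one long block, so its probability is bounded below by a
  product.\<close>

lemma tube_prob_pos:
  assumes \<kappa>: "1/2 < \<kappa>" and s: "0 \<le> s" and b: "0 \<le> b" "b < (s + 1) powr \<kappa>"
  obtains c where "0 < c"
    and "\<And>V. \<exists>A\<in>events. c \<le> prob A \<and>
      (\<forall>\<omega>\<in>A. \<forall>u\<in>{0..V}. \<forall>y. \<bar>y\<bar> \<le> b \<longrightarrow> \<bar>y + W u \<omega>\<bar> < (s + 1 + u) powr \<kappa>)"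
proof -
  define a where "a = (s + 1) powr \<kappa>"
  \<comment> \<open>One \<open>e\<close> pays for the displacement at a block start, a second for
    the oscillation within the block, and the third keeps the inequality strict.\<close>
  define e where "e = (a - b) / 3"
  have e: "0 < e" "b + 2 * e < a" using b by (auto simp: e_def a_def field_simps)
  obtain T0 where T0: "0 < T0"
    "\<And>T V. T0 \<le> T \<Longrightarrow> 1/2 \<le> prob {\<omega>\<in>space M. \<forall>u\<in>{T..V}. \<bar>W u \<omega> - W T \<omega>\<bar> \<le> u powr \<kappa> / 2}"
    using late_increments_prob_ge[OF \<kappa>] by blast
  \<comment> \<open>With \<open>u \<ge> T \<ge> 3 * (s + 1)\<close> the boundary is at least
    \<open>4 powr \<kappa> * a\<close>, hence at least \<open>2 * a\<close>: half of it covers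
    \<open>b + 2 * e\<close>, the other half covers \<open>u powr \<kappa> / 2\<close>.\<close>
  define T where "T = max T0 (3 * (s + 1))"
  have T: "0 < T" "T0 \<le> T" "3 * (s + 1) \<le> T" using T0(1) by (auto simp: T_def)
  obtain N :: nat where N: "0 < N" and
    N_pos: "\<And>i :: nat. 0 < prob {\<omega>\<in>space M.
      (\<forall>u\<in>{real i * (T / N)..real (Suc i) * (T / N)}. \<bar>W u \<omega> - W (real i * (T / N)) \<omega>\<bar> \<le> e) \<and>
      \<bar>W (real (Suc i) * (T / N)) \<omega> - W (real i * (T / N)) \<omega>\<bar> \<le> e / N}"
    using small_block_prob_pos[OF T(1) e(1)] by blast
  define h where "h = T / real N"
  have h: "0 < h" "real N * h = T" using T N by (auto simp: h_def)
  define B where "B i = {\<omega>\<in>space M.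
      (\<forall>u\<in>{real i * h..real (Suc i) * h}. \<bar>W u \<omega> - W (real i * h) \<omega>\<bar> \<le> e) \<and>
      \<bar>W (real (Suc i) * h) \<omega> - W (real i * h) \<omega>\<bar> \<le> e / N}" for i :: nat
  define c where "c = (\<Prod>i<N. prob (B i)) * (1/2)"
  have "0 < c" unfolding c_def B_def h_def using N_pos by (auto intro!: mult_pos_pos prod_pos)
  moreover have "\<exists>A\<in>events. c \<le> prob A \<and>
      (\<forall>\<omega>\<in>A. \<forall>u\<in>{0..V}. \<forall>y. \<bar>y\<bar> \<le> b \<longrightarrow> \<bar>y + W u \<omega>\<bar> < (s + 1 + u) powr \<kappa>)" for V
  proof -
    \<comment> \<open>The last block has to end at a multiple of \<open>h\<close>, so the horizon is
      enlarged to such a multiple \<open>V'\<close> beyond both \<open>V\<close> and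
      \<open>T\<close>.\<close>
    obtain L0 :: nat where L0: "V / h < real L0" using reals_Archimedean2 by blast
    define K where "K = N + L0"
    define V' where "V' = real K * h"
    have V': "V \<le> V'" "T \<le> V'"
    proof -
      have "V \<le> real L0 * h" using L0 h by (simp add: field_simps)
      then show "V \<le> V'" using T h by (simp add: V'_def K_def distrib_right)
      show "T \<le> V'" using h by (simp add: V'_def K_def distrib_right)
    qed
    define n where "n i = (if i \<le> N then i else K)" for i
    define \<beta> where "\<beta> i = (if i < N then (\<lambda>_. e) else (\<lambda>u. u powr \<kappa> / 2))" for i
    \<comment> \<open>For the long block this is the path bound evaluated at \<open>V'\<close>, so
      it adds no constraint there.\<close>
    define \<eta> where "\<eta> i = (if i < N then e / N else V' powr \<kappa> / 2)" for i
    define E where "E i = {\<omega>\<in>space M. (\<forall>u\<in>{real (n i) * h..real (n (Suc i)) * h}.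
      \<bar>W u \<omega> - W (real (n i) * h) \<omega>\<bar> \<le> \<beta> i u) \<and>
      \<bar>W (real (n (Suc i)) * h) \<omega> - W (real (n i) * h) \<omega>\<bar> \<le> \<eta> i}" for i
    have cont: "continuous_on {real (n i) * h..real (n (Suc i)) * h} (\<beta> i)" if "i < Suc N" for i
    proof (cases "i < N")
      case True
      then show ?thesis by (simp add: \<beta>_def)
    next
      case False
      then have "i = N" using that by simp
      then show ?thesis using h T by (auto simp: \<beta>_def n_def intro!: continuous_intros)
    qed
    define A where "A = {\<omega>\<in>space M. \<forall>i<Suc N. \<omega> \<in> E i}"
    have E_B: "E i = B i" if "i < N" for i
      using that by (simp add: E_def B_def n_def \<beta>_def \<eta>_def)
    have E_N: "E N = {\<omega>\<in>space M. \<forall>u\<in>{T..V'}. \<bar>W u \<omega> - W T \<omega>\<bar> \<le> u powr \<kappa> / 2}"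
      using V' h by (auto simp: E_def n_def \<beta>_def \<eta>_def V'_def)
    have A_sets: "A \<in> events"
    proof -
      have "E i \<in> events" if i: "i < Suc N" for i
      proof -
        have 0: "0 \<le> real (n i) * h" for i using h by simp
        have [measurable]: "W (real (n i) * h) \<in> borel_measurable M" for i
          using 0 by (intro W_measurable)
        have "E i = {\<omega>\<in>space M. \<forall>u\<in>{real (n i) * h..real (n (Suc i)) * h}.
            \<bar>W u \<omega> - W (real (n i) * h) \<omega>\<bar> \<le> \<beta> i u} \<inter>
          {\<omega>\<in>space M. \<bar>W (real (n (Suc i)) * h) \<omega> - W (real (n i) * h) \<omega>\<bar> \<le> \<eta> i}"
          by (auto simp: E_def)
        also have "\<dots> \<in> events"
          using path_bound_measurable[OF 0 cont[OF i]] by (rule sets.Int) measurable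
        finally show ?thesis .
      qed
      then have "(\<Inter>i<Suc N. E i) \<in> events" by (intro sets.finite_INT) auto
      moreover have "A = (\<Inter>i<Suc N. E i)" by (auto simp: A_def E_def)
      ultimately show ?thesis by simp
    qed
    have "c \<le> (\<Prod>i<N. prob (E i)) * prob (E N)"
      unfolding c_def E_N using T0(2)[OF T(2), of V'] E_B
      by (intro mult_mono prod_mono) (auto intro: prod_nonneg)
    also have "\<dots> = (\<Prod>i<Suc N. prob (E i))" by simp
    also have "\<dots> \<le> prob A"
      unfolding A_def E_def
      by (rule path_blocks_prob_ge[OF h(1)]) (use cont in \<open>auto simp: n_def K_def\<close>)
    finally have A_ge: "c \<le> prob A" .
    have "\<bar>y + W u \<omega>\<bar> < (s + 1 + u) powr \<kappa>"
      if \<omega>: "\<omega> \<in> A" and u: "u \<in> {0..V}" and y: "\<bar>y\<bar> \<le> b" for \<omega> u y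
    proof -
      have sp: "\<omega> \<in> space M" and EB: "\<And>i. i < N \<Longrightarrow> \<omega> \<in> B i" and EN: "\<omega> \<in> E N"
        using \<omega> E_B by (auto simp: A_def less_Suc_eq)
      \<comment> \<open>At most \<open>N\<close> increments of size \<open>e / N\<close> add up to
        no more than \<open>e\<close>.\<close>
      have grid: "\<bar>W (real i * h) \<omega>\<bar> \<le> real i * (e / N)" if "i \<le> N" for i
        using that
      proof (induction i)
        case 0
        then show ?case using W_zero[OF sp] by simp
      next
        case (Suc i)
        then have "\<bar>W (real (Suc i) * h) \<omega> - W (real i * h) \<omega>\<bar> \<le> e / N"
          using EB[of i] by (simp add: B_def)
        moreover have "\<bar>W (real i * h) \<omega>\<bar> \<le> real i * (e / N)" using Suc by simp
        moreover have "real (Suc i) * (e / N) = real i * (e / N) + e / N"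
          by (simp only: of_nat_Suc distrib_right mult_1)
        ultimately show ?case by linarith
      qed
      have grid_e: "\<bar>W (real i * h) \<omega>\<bar> \<le> e" if "i \<le> N" for i
      proof -
        have "real i * (e / N) \<le> real N * (e / N)"
          using that e by (intro mult_right_mono) auto
        then show ?thesis using grid[OF that] N by simp
      qed
      show ?thesis
      proof (cases "u < T")
        case True
        define i where "i = nat \<lfloor>u / h\<rfloor>"
        have ru: "real i \<le> u / h" "u / h < real i + 1"
        proof -
          have "0 \<le> u / h" using u h by auto
          then have "real i = real_of_int \<lfloor>u / h\<rfloor>" unfolding i_def by simp
          then show "real i \<le> u / h" "u / h < real i + 1" by linarith+
        qed
        have iu: "real i * h \<le> u" "u \<le> real (Suc i) * h"
          using ru h by (auto simp: field_simps)
        then have "real i * h < real N * h" using True h by simp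
        then have i: "i < N" using h(1) by (simp only: mult_less_cancel_right_pos of_nat_less_iff)
        have "\<bar>W u \<omega> - W (real i * h) \<omega>\<bar> \<le> e"
          using EB[OF i] iu by (auto simp: B_def)
        then have "\<bar>y + W u \<omega>\<bar> \<le> b + 2 * e" using grid_e[of i] i y by linarith
        also have "\<dots> < a" by fact
        also have "a \<le> (s + 1 + u) powr \<kappa>"
          unfolding a_def using u s \<kappa> by (intro powr_mono2) auto
        finally show ?thesis .
      next
        case False
        then have uT: "u \<in> {T..V'}" using u V' by auto
        then have "\<bar>W u \<omega> - W T \<omega>\<bar> \<le> u powr \<kappa> / 2" using EN by (auto simp: E_N)
        moreover have "\<bar>W T \<omega>\<bar> \<le> e" using grid_e[of N] h by simp
        ultimately have "\<bar>y + W u \<omega>\<bar> \<le> b + 2 * e + u powr \<kappa> / 2" using y e by linarith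
        also have "\<dots> < a + u powr \<kappa> / 2" using e by simp
        also have "\<dots> \<le> (s + 1 + u) powr \<kappa> / 2 + (s + 1 + u) powr \<kappa> / 2"
        proof (intro add_mono)
          have "a * 2 \<le> a * 4 powr \<kappa>"
            using powr_mono[of "1/2" \<kappa> 4] \<kappa> by (intro mult_left_mono) (auto simp: a_def powr_half_sqrt)
          also have "\<dots> = (4 * (s + 1)) powr \<kappa>" using s by (subst powr_mult) (auto simp: a_def)
          also have "\<dots> \<le> (s + 1 + u) powr \<kappa>"
            using uT T s \<kappa> by (intro powr_mono2) auto
          finally show "a \<le> (s + 1 + u) powr \<kappa> / 2" by simp
          show "u powr \<kappa> / 2 \<le> (s + 1 + u) powr \<kappa> / 2"
            using u s \<kappa> by (intro divide_right_mono powr_mono2) auto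
        qed
        finally show ?thesis by simp
      qed
    qed
    then show ?thesis using A_sets A_ge by blast
  qed
  ultimately show thesis using that by blast
qed

section \<open>The process, its hitting time and its tail\<close>

lemma Xproc_continuous:
  assumes "\<omega> \<in> space M" "0 \<le> s"
  shows "continuous_on {s..} (\<lambda>r. Xproc \<kappa> s x W r \<omega>)"
proof -
  have "continuous_on {s..} (\<lambda>r. W (r - s) \<omega>)"
    by (rule continuous_on_compose2[OF W_continuous[OF assms(1)]]) (auto intro!: continuous_intros)
  then show ?thesis
    unfolding Xproc_def using assms(2) by (intro continuous_intros) auto
qed

text \<open>The delicate direction is from right to left, where hits immediately after
  \<open>t\<close> could make the infimum equal to \<open>t\<close>. Continuity at \<open>t\<close>
  excludes them on an interval of some length \<open>d\<close>.\<close>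

lemma less_hit_time_iff:
  assumes \<omega>: "\<omega> \<in> space M" and s: "0 \<le> s" "s \<le> t"
  shows "ereal t < hit_time \<kappa> s x W \<omega> \<longleftrightarrow> (\<forall>r\<in>{s..t}. \<bar>Xproc \<kappa> s x W r \<omega>\<bar> \<noteq> 1)"
proof
  assume L: "ereal t < hit_time \<kappa> s x W \<omega>"
  show "\<forall>r\<in>{s..t}. \<bar>Xproc \<kappa> s x W r \<omega>\<bar> \<noteq> 1"
  proof (intro ballI notI)
    fix r assume r: "r \<in> {s..t}" "\<bar>Xproc \<kappa> s x W r \<omega>\<bar> = 1"
    then have "hit_time \<kappa> s x W \<omega> \<le> ereal r"
      unfolding hit_time_def by (intro Inf_lower) auto
    also have "\<dots> \<le> ereal t" using r by simp
    finally show False using L by simp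
  qed
next
  assume R: "\<forall>r\<in>{s..t}. \<bar>Xproc \<kappa> s x W r \<omega>\<bar> \<noteq> 1"
  let ?g = "\<lambda>r. \<bar>Xproc \<kappa> s x W r \<omega>\<bar>"
  have "continuous_on {s..} ?g"
    by (intro continuous_intros Xproc_continuous \<omega> s)
  then have "(?g \<longlongrightarrow> ?g t) (at t within {s..})"
    using s by (auto simp: continuous_on_def)
  moreover have "?g t \<noteq> 1" using R s by simp
  ultimately have "\<forall>\<^sub>F r in at t within {s..}. ?g r \<noteq> 1"
    by (rule tendsto_imp_eventually_ne)
  then obtain d where d: "0 < d" "\<And>r. r \<in> {s..} \<Longrightarrow> r \<noteq> t \<Longrightarrow> dist r t < d \<Longrightarrow> ?g r \<noteq> 1"
    unfolding eventually_at by blast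
  \<comment> \<open>A path that never hits is included: the infimum of the empty set is
    infinite.\<close>
  have "ereal (t + d) \<le> hit_time \<kappa> s x W \<omega>"
    unfolding hit_time_def
  proof (rule Inf_greatest, clarsimp)
    fix r assume r: "s \<le> r" "?g r = 1"
    then have "t < r" using R by (cases "r \<le> t") auto
    then show "t + d \<le> r" using d(2)[of r] r by (cases "r < t + d") (auto simp: dist_real_def)
  qed
  moreover have "ereal t < ereal (t + d)" using d by simp
  ultimately show "ereal t < hit_time \<kappa> s x W \<omega>" by (rule less_le_trans[rotated])
qed

text \<open>Survival in terms of countably many times; this yields measurability jointly in starting
  point and path, as integration against \<open>\<mu>\<close> requires.\<close>

lemma less_hit_time_iff_grid:
  assumes \<omega>: "\<omega> \<in> space M" and s: "0 \<le> s" "s \<le> t"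
  shows "ereal t < hit_time \<kappa> s x W \<omega> \<longleftrightarrow>
    (\<exists>n. \<forall>m k. s + real k * 1 / 2 ^ m \<le> t \<longrightarrow>
      1 / real (Suc n) \<le> \<bar>\<bar>Xproc \<kappa> s x W (s + real k * 1 / 2 ^ m) \<omega>\<bar> - 1\<bar>)"
proof -
  have "continuous_on {s..t} (\<lambda>r. \<bar>Xproc \<kappa> s x W r \<omega>\<bar> - 1)"
    by (intro continuous_intros continuous_on_subset[OF Xproc_continuous[OF \<omega> s(1)]]) auto
  from nonvanishing_iff_dyadic_grid[OF this s(2) zero_less_one] show ?thesis
    unfolding less_hit_time_iff[OF \<omega> s] by simp
qed

lemma Xproc_measurable_pair:
  assumes "0 \<le> s" "s \<le> t"
  shows "(\<lambda>(x, \<omega>). Xproc \<kappa> s x W t \<omega>) \<in> borel_measurable (borel \<Otimes>\<^sub>M M)"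
proof -
  have [measurable]: "W (t - s) \<in> borel_measurable M"
    using assms by (intro W_measurable) auto
  show ?thesis unfolding Xproc_def by measurable
qed

lemma survival_set_measurable:
  assumes "0 \<le> s" "s \<le> t"
  shows "{z \<in> space (borel \<Otimes>\<^sub>M M). ereal t < hit_time \<kappa> s (fst z) W (snd z)} \<in> sets (borel \<Otimes>\<^sub>M M)"
proof -
  have [measurable]: "(\<lambda>z. Xproc \<kappa> s (fst z) W (s + real k * 1 / 2 ^ m) (snd z)) \<in> borel_measurable (borel \<Otimes>\<^sub>M M)" for k m
    using Xproc_measurable_pair[of s "s + real k * 1 / 2 ^ m"] assms by (simp add: case_prod_beta)
  have "{z \<in> space (borel \<Otimes>\<^sub>M M). ereal t < hit_time \<kappa> s (fst z) W (snd z)} =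
    {z \<in> space (borel \<Otimes>\<^sub>M M). \<exists>n. \<forall>m k. s + real k * 1 / 2 ^ m \<le> t \<longrightarrow>
      1 / real (Suc n) \<le> \<bar>\<bar>Xproc \<kappa> s (fst z) W (s + real k * 1 / 2 ^ m) (snd z)\<bar> - 1\<bar>}"
    by (intro Collect_cong conj_cong refl less_hit_time_iff_grid assms) (auto simp: space_pair_measure)
  also have "\<dots> \<in> sets (borel \<Otimes>\<^sub>M M)" by measurable
  finally show ?thesis .
qed

text \<open>Multiplying by \<open>(r + 1) powr \<kappa>\<close> turns the level \<open>1\<close> for
  \<open>X\<close> into the moving boundary of \<open>tube_prob_pos\<close> at time
  \<open>u = r - s\<close>. The bound is uniform over starting points in \<open>[-b, b]\<close> and
  over \<open>t\<close>.\<close>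

lemma survival_prob_ge:
  assumes \<kappa>: "1/2 < \<kappa>" and s: "0 \<le> s" and b: "0 \<le> b" "b < 1"
  obtains c where "0 < c"
    and "\<And>x t. \<bar>x\<bar> \<le> b \<Longrightarrow> s \<le> t \<Longrightarrow> c \<le> prob {\<omega>\<in>space M. ereal t < hit_time \<kappa> s x W \<omega>}"
proof -
  let ?a = "(s + 1) powr \<kappa>"
  have a: "0 < ?a" using s by simp
  obtain c where c: "0 < c" and
    A: "\<And>V. \<exists>A\<in>events. c \<le> prob A \<and>
      (\<forall>\<omega>\<in>A. \<forall>u\<in>{0..V}. \<forall>y. \<bar>y\<bar> \<le> b * ?a \<longrightarrow> \<bar>y + W u \<omega>\<bar> < (s + 1 + u) powr \<kappa>)"
    using tube_prob_pos[OF \<kappa> s, of "b * ?a"] b a by auto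
  have "c \<le> prob {\<omega>\<in>space M. ereal t < hit_time \<kappa> s x W \<omega>}" (is "_ \<le> prob ?S")
    if x: "\<bar>x\<bar> \<le> b" and t: "s \<le> t" for x t
  proof -
    obtain A where A: "A \<in> events" "c \<le> prob A"
      "\<And>\<omega> u y. \<omega> \<in> A \<Longrightarrow> u \<in> {0..t - s} \<Longrightarrow> \<bar>y\<bar> \<le> b * ?a \<Longrightarrow> \<bar>y + W u \<omega>\<bar> < (s + 1 + u) powr \<kappa>"
      using A[of "t - s"] by blast
    have "?S = Pair x -` {z \<in> space (borel \<Otimes>\<^sub>M M). ereal t < hit_time \<kappa> s (fst z) W (snd z)}"
      by (auto simp: space_pair_measure)
    then have S: "?S \<in> events"
      using sets_Pair1[OF survival_set_measurable[OF s t]] by simp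
    have "A \<subseteq> ?S"
    proof
      fix \<omega> assume \<omega>: "\<omega> \<in> A"
      then have sp: "\<omega> \<in> space M" using A(1) sets.sets_into_space by blast
      have "\<bar>Xproc \<kappa> s x W r \<omega>\<bar> \<noteq> 1" if r: "r \<in> {s..t}" for r
      proof -
        have "\<bar>x * ?a\<bar> \<le> b * ?a" using x a by (simp add: abs_mult)
        then have "\<bar>x * ?a + W (r - s) \<omega>\<bar> < (s + 1 + (r - s)) powr \<kappa>"
          using A(3)[OF \<omega>, of "r - s" "x * ?a"] r by auto
        then have "\<bar>x * ?a + W (r - s) \<omega>\<bar> < (r + 1) powr \<kappa>" by (simp add: algebra_simps)
        then show ?thesis using r s by (simp add: Xproc_def)
      qed
      then show "\<omega> \<in> ?S" using less_hit_time_iff[OF sp s t] sp by auto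
    qed
    then show ?thesis using finite_measure_mono[OF _ S, of A] A(2) by linarith
  qed
  then show thesis using c that by blast
qed

text \<open>Once the starting term is at most half of \<open>d * (t + 1) powr \<kappa>\<close>, a
  large value of \<open>X\<close> forces \<open>W\<close> to exceed the other half. The time
  threshold is the same for all starting points.\<close>

lemma Xproc_tail_le:
  assumes \<kappa>: "1/2 < \<kappa>" and s: "0 \<le> s" and d: "0 < d" and p: "0 < p"
  shows "\<forall>\<^sub>F t in at_top. \<forall>x. \<bar>x\<bar> < 1 \<longrightarrow> prob {\<omega>\<in>space M. d < \<bar>Xproc \<kappa> s x W t \<omega>\<bar>} \<le> p"
proof -
  have shift: "filterlim (\<lambda>t::real. t + 1) at_top at_top"
    by (rule filterlim_tendsto_add_at_top[OF tendsto_const filterlim_ident, of 1, simplified add.commute])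
  \<comment> \<open>\<open>48\<close> is \<open>3 * 2 ^ 4\<close>: the constant of
    \<open>increment_tail\<close> and the halving of \<open>d\<close>.\<close>
  have "((\<lambda>t. 48 / d ^ 4 * (t + 1) powr (2 - 4 * \<kappa>)) \<longlongrightarrow> 48 / d ^ 4 * 0) at_top"
    using \<kappa> by (intro tendsto_intros tendsto_neg_powr shift) auto
  then have "\<forall>\<^sub>F t in at_top. 48 / d ^ 4 * (t + 1) powr (2 - 4 * \<kappa>) < p"
    using p by (intro order_tendstoD) auto
  moreover have "((\<lambda>t. (t + 1) powr (- \<kappa>)) \<longlongrightarrow> 0) at_top"
    using \<kappa> by (intro tendsto_neg_powr shift) auto
  then have "\<forall>\<^sub>F t in at_top. (t + 1) powr (- \<kappa>) < d / (2 * (s + 1) powr \<kappa>)"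
    using d s by (intro order_tendstoD) auto
  ultimately show ?thesis
    using eventually_gt_at_top[of s]
  proof eventually_elim
    case (elim t)
    let ?a = "(s + 1) powr \<kappa>" and ?b = "(t + 1) powr \<kappa>"
    let ?e = "d / 2 * ?b"
    have b: "0 < ?b" and e: "0 < ?e" using elim s d by auto
    have ae: "?a \<le> ?e" using elim(2) b d s by (simp add: powr_minus_divide field_simps)
    have [measurable]: "W (t - s) \<in> borel_measurable M" "W 0 \<in> borel_measurable M"
      using elim by (auto intro: W_measurable)
    have "(t - s)\<^sup>2 \<le> (t + 1)\<^sup>2" using elim s by (intro power_mono) auto
    then have "3 * (t - s)\<^sup>2 / ?e ^ 4 \<le> 3 * (t + 1)\<^sup>2 / ?e ^ 4"
      by (intro divide_right_mono) auto
    also have "\<dots> = 48 / d ^ 4 * ((t + 1) powr 2 / (t + 1) powr (4 * \<kappa>))"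
      using elim s by (simp add: power_mult_distrib power_divide powr_power mult.commute)
    also have "\<dots> = 48 / d ^ 4 * (t + 1) powr (2 - 4 * \<kappa>)" by (simp only: powr_diff)
    finally have le: "3 * (t - s)\<^sup>2 / ?e ^ 4 \<le> p" using elim(1) by linarith
    show ?case
    proof (intro allI impI)
      fix x :: real assume x: "\<bar>x\<bar> < 1"
      have "prob {\<omega>\<in>space M. d < \<bar>Xproc \<kappa> s x W t \<omega>\<bar>} \<le> prob {\<omega>\<in>space M. ?e < \<bar>W (t - s) \<omega> - W 0 \<omega>\<bar>}"
      proof (rule finite_measure_mono)
        show "{\<omega>\<in>space M. d < \<bar>Xproc \<kappa> s x W t \<omega>\<bar>} \<subseteq> {\<omega>\<in>space M. ?e < \<bar>W (t - s) \<omega> - W 0 \<omega>\<bar>}"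
        proof clarify
          fix \<omega> assume \<omega>: "\<omega> \<in> space M" "d < \<bar>Xproc \<kappa> s x W t \<omega>\<bar>"
          then have "d * ?b < \<bar>x * ?a + W (t - s) \<omega>\<bar>"
            using b by (simp add: Xproc_def field_simps)
          moreover have "\<bar>x * ?a\<bar> \<le> ?a" using x by (simp add: abs_mult mult_left_le_one_le)
          ultimately show "?e < \<bar>W (t - s) \<omega> - W 0 \<omega>\<bar>" using ae W_zero[OF \<omega>(1)] by auto
        qed
      qed measurable
      also have "\<dots> \<le> 3 * (t - s)\<^sup>2 / ?e ^ 4"
        using increment_tail[of 0 "t - s" ?e] elim e by simp
      finally show "prob {\<omega>\<in>space M. d < \<bar>Xproc \<kappa> s x W t \<omega>\<bar>} \<le> p" using le by linarith
    qed
  qed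
qed

end

section \<open>Convergence of the conditional laws\<close>

theorem theorem1:
  fixes M :: "'a measure" and W :: "real \<Rightarrow> 'a \<Rightarrow> real"
    and \<mu> :: "real measure" and \<kappa> s :: real
  assumes "\<kappa> > 1/2"
    and "brownian_motion M W"
    and "prob_space \<mu>" and "sets \<mu> = sets borel" and "measure \<mu> {-1<..<1} = 1"
    and "s \<ge> 0"
  shows "\<forall>f :: real \<Rightarrow> real. continuous_on UNIV f \<and> bounded (range f) \<longrightarrow>
           ((\<lambda>t. cond_expect M W \<mu> \<kappa> s f t) \<longlongrightarrow> f 0) at_top"
proof (intro allI impI, elim conjE)
  fix f :: "real \<Rightarrow> real"
  assume cont: "continuous_on UNIV f" and bdd: "bounded (range f)"
  note \<kappa> = assms(1) and s = assms(6)
  interpret brownian_path M W using assms(2) by unfold_locales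
  interpret \<mu>: prob_space \<mu> by fact
  have [measurable_cong]: "sets \<mu> = sets borel" by fact
  have [measurable]: "f \<in> borel_measurable borel" using cont by (rule borel_measurable_continuous_onI)
  obtain B where B: "0 < B" "\<And>y. \<bar>f y\<bar> \<le> B"
    using bdd by (auto simp: bounded_pos)
  have inside: "AE x in \<mu>. \<bar>x\<bar> < 1"
  proof -
    have "AE x in \<mu>. x \<in> {-1<..<1}"
      using assms(5) by (subst \<mu>.AE_in_set_eq_1) auto
    then show ?thesis by eventually_elim auto
  qed
  \<comment> \<open>The survival bound is uniform only away from the endpoints, so a symmetric
    closed interval inside \<open>(-1, 1)\<close> carrying some mass of \<open>\<mu>\<close> is
    selected; such intervals exhaust \<open>(-1, 1)\<close>.\<close>
  obtain r where r: "0 \<le> r" "r < 1" "0 < measure \<mu> {-r..r}"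
  proof -
    define I where "I n = {-(1 - 1 / real (Suc n))..1 - 1 / real (Suc n)}" for n
    have "incseq I"
      unfolding I_def by (intro incseq_SucI) (auto simp: field_simps)
    moreover have "range I \<subseteq> sets \<mu>" by (auto simp: I_def assms(4))
    ultimately have "(\<lambda>n. measure \<mu> (I n)) \<longlonglongrightarrow> measure \<mu> (\<Union>n. I n)"
      by (intro \<mu>.finite_Lim_measure_incseq)
    also have "(\<Union>n. I n) = {-1<..<1}"
    proof (intro equalityI subsetI)
      fix x :: real assume "x \<in> {-1<..<1}"
      then have "0 < 1 - \<bar>x\<bar>" by auto
      then obtain n where "1 / real (Suc n) < 1 - \<bar>x\<bar>" using nat_approx_posE by blast
      then have "x \<in> I n" by (auto simp: I_def)
      then show "x \<in> (\<Union>n. I n)" by blast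
    next
      fix x assume "x \<in> (\<Union>n. I n)"
      then obtain n where "x \<in> I n" by blast
      moreover have "0 < 1 / real (Suc n)" by simp
      ultimately show "x \<in> {-1<..<1}" unfolding I_def atLeastAtMost_iff greaterThanLessThan_iff by linarith
    qed
    finally have "\<forall>\<^sub>F n in sequentially. 0 < measure \<mu> (I n)"
      using assms(5) by (intro order_tendstoD) auto
    then obtain n where "0 < measure \<mu> (I n)" by (auto simp: eventually_sequentially)
    then show thesis using that[of "1 - 1 / real (Suc n)"] by (simp add: I_def)
  qed
  obtain c where c: "0 < c" and
    c_le: "\<And>x t. \<bar>x\<bar> \<le> r \<Longrightarrow> s \<le> t \<Longrightarrow> c \<le> prob {\<omega>\<in>space M. ereal t < hit_time \<kappa> s x W \<omega>}"
    using survival_prob_ge[OF \<kappa> s r(1,2)] by blast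
  define q where "q = c * measure \<mu> {-r..r}"
  have q: "0 < q" using c r by (simp add: q_def)
  \<comment> \<open>The first bound keeps only starting points in \<open>[-r, r]\<close>. The second
    drops the survival indicator: \<open>f\<close> differs from \<open>f 0\<close> by at most
    \<open>e\<close> where \<open>X\<close> is within \<open>d\<close>, and by at most
    \<open>2 * B\<close> elsewhere.\<close>
  have surv: "q \<le> surv_prob M W \<mu> \<kappa> s t"
    and diff: "\<bar>surv_expect M W \<mu> \<kappa> s f t - f 0 * surv_prob M W \<mu> \<kappa> s t\<bar> \<le> e + 2 * B * p"
    if t: "s \<le> t" and e: "0 < e" "\<And>y. \<bar>y\<bar> \<le> d \<Longrightarrow> \<bar>f y - f 0\<bar> \<le> e"
      and p: "0 < p" "\<And>x. \<bar>x\<bar> < 1 \<Longrightarrow> prob {\<omega>\<in>space M. d < \<bar>Xproc \<kappa> s x W t \<omega>\<bar>} \<le> p" for t d e p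
  proof -
    define S where "S x = {\<omega>\<in>space M. ereal t < hit_time \<kappa> s x W \<omega>}" for x
    define X where "X x \<omega> = Xproc \<kappa> s x W t \<omega>" for x \<omega>
    have X_pair[measurable]: "(\<lambda>(x, \<omega>). X x \<omega>) \<in> borel_measurable (borel \<Otimes>\<^sub>M M)"
      unfolding X_def by (rule Xproc_measurable_pair[OF s t])
    have S_pair[measurable]: "(\<lambda>(x, \<omega>). indicator (S x) \<omega> :: real) \<in> borel_measurable (borel \<Otimes>\<^sub>M M)"
    proof -
      have "(\<lambda>z. indicator {z \<in> space (borel \<Otimes>\<^sub>M M). ereal t < hit_time \<kappa> s (fst z) W (snd z)} z :: real)
        \<in> borel_measurable (borel \<Otimes>\<^sub>M M)"
        using survival_set_measurable[OF s t, of \<kappa>] by (rule borel_measurable_indicator)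
      then show ?thesis
        by (rule measurable_cong[THEN iffD1, rotated]) (auto simp: S_def space_pair_measure indicator_def)
    qed
    have S: "S x \<in> events" for x
    proof -
      have "S x = Pair x -` {z \<in> space (borel \<Otimes>\<^sub>M M). ereal t < hit_time \<kappa> s (fst z) W (snd z)}"
        by (auto simp: S_def space_pair_measure)
      then show ?thesis using sets_Pair1[OF survival_set_measurable[OF s t]] by simp
    qed
    have X[measurable]: "X x \<in> borel_measurable M" for x
      using measurable_Pair2[OF X_pair, of x] by simp
    have prob_S: "prob (S x) = (\<integral>\<omega>. indicator (S x) \<omega> \<partial>M)" for x
      using S by simp
    have mS[measurable]: "(\<lambda>x. prob (S x)) \<in> borel_measurable borel"
      unfolding prob_S by measurable
    have mF[measurable]: "(\<lambda>x. \<integral>\<omega>. f (X x \<omega>) * indicator (S x) \<omega> \<partial>M) \<in> borel_measurable borel"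
      by measurable
    have intS: "integrable \<mu> (\<lambda>x. prob (S x))"
      by (rule \<mu>.integrable_const_bound[of _ 1]) auto
    have fS: "integrable M (\<lambda>\<omega>. f (X x \<omega>) * indicator (S x) \<omega>)" for x
      using B S by (intro integrable_const_bound[of _ B] AE_I2) (auto simp: indicator_def abs_mult intro: less_imp_le)
    have "\<bar>\<integral>\<omega>. f (X x \<omega>) * indicator (S x) \<omega> \<partial>M\<bar> \<le> B" for x
    proof -
      have "\<bar>\<integral>\<omega>. f (X x \<omega>) * indicator (S x) \<omega> \<partial>M\<bar> \<le> (\<integral>\<omega>. \<bar>f (X x \<omega>) * indicator (S x) \<omega>\<bar> \<partial>M)"
        by (rule integral_abs_bound)
      also have "\<dots> \<le> (\<integral>\<omega>. B \<partial>M)"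
        using fS B by (intro integral_mono integrable_abs) (auto simp: indicator_def intro: less_imp_le)
      finally show ?thesis by (simp add: prob_space)
    qed
    then have intF: "integrable \<mu> (\<lambda>x. \<integral>\<omega>. f (X x \<omega>) * indicator (S x) \<omega> \<partial>M)"
      by (intro \<mu>.integrable_const_bound[of _ B]) auto
    have "q = (\<integral>x. c * indicator {-r..r} x \<partial>\<mu>)" by (simp add: q_def)
    also have "\<dots> \<le> (\<integral>x. prob (S x) \<partial>\<mu>)"
    proof (rule integral_mono)
      show "integrable \<mu> (\<lambda>x. c * indicator {-r..r} x)"
        by (intro integrable_mult_right integrable_real_indicator) (auto simp: assms(4) \<mu>.emeasure_eq_measure)
      show "c * indicator {-r..r} x \<le> prob (S x)" for x
        using c_le[of x t] t by (cases "x \<in> {-r..r}") (auto simp: S_def abs_le_iff)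
    qed (rule intS)
    also have "\<dots> = surv_prob M W \<mu> \<kappa> s t" by (simp add: surv_prob_def S_def)
    finally show "q \<le> surv_prob M W \<mu> \<kappa> s t" .

    have inner: "\<bar>(\<integral>\<omega>. f (X x \<omega>) * indicator (S x) \<omega> \<partial>M) - f 0 * prob (S x)\<bar> \<le> e + 2 * B * p"
      if x: "\<bar>x\<bar> < 1" for x
    proof -
      let ?D = "{\<omega>\<in>space M. d < \<bar>X x \<omega>\<bar>}"
      have D: "?D \<in> events" by measurable
      have iS: "integrable M (\<lambda>\<omega>. f 0 * indicator (S x) \<omega>)"
        using S by (intro integrable_mult_right integrable_real_indicator) (auto simp: emeasure_eq_measure)
      have "(\<integral>\<omega>. f (X x \<omega>) * indicator (S x) \<omega> \<partial>M) - f 0 * prob (S x)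
        = (\<integral>\<omega>. f (X x \<omega>) * indicator (S x) \<omega> - f 0 * indicator (S x) \<omega> \<partial>M)"
        using S by (subst Bochner_Integration.integral_diff[OF fS iS]) simp
      also have "\<bar>\<dots>\<bar> \<le> (\<integral>\<omega>. \<bar>f (X x \<omega>) * indicator (S x) \<omega> - f 0 * indicator (S x) \<omega>\<bar> \<partial>M)"
        by (rule integral_abs_bound)
      also have "\<dots> \<le> (\<integral>\<omega>. e + 2 * B * indicator ?D \<omega> \<partial>M)"
      proof (rule integral_mono)
        show "integrable M (\<lambda>\<omega>. e + 2 * B * indicator ?D \<omega>)"
          using D by (intro Bochner_Integration.integrable_add integrable_mult_right integrable_real_indicator)
            (auto simp: emeasure_eq_measure)
        fix \<omega> assume \<omega>: "\<omega> \<in> space M"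
        have "\<bar>f (X x \<omega>) - f 0\<bar> \<le> e + 2 * B * indicator ?D \<omega>"
        proof (cases "\<omega> \<in> ?D")
          case True
          then show ?thesis using B(2)[of "X x \<omega>"] B(2)[of 0] e(1) by simp
        next
          case False
          then show ?thesis using e(2)[of "X x \<omega>"] \<omega> by simp
        qed
        moreover have "0 \<le> e + 2 * B * indicator ?D \<omega>" using e(1) B(1) by simp
        ultimately show "\<bar>f (X x \<omega>) * indicator (S x) \<omega> - f 0 * indicator (S x) \<omega>\<bar> \<le> e + 2 * B * indicator ?D \<omega>"
          by (cases "\<omega> \<in> S x") simp_all
      qed (intro integrable_abs Bochner_Integration.integrable_diff fS iS)
      also have "\<dots> = e + 2 * B * prob ?D"
        using D by (subst Bochner_Integration.integral_add)
          (auto simp: emeasure_eq_measure prob_space intro!: integrable_mult_right integrable_real_indicator)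
      also have "\<dots> \<le> e + 2 * B * p"
        using p(2)[OF x] B(1) unfolding X_def by (intro add_left_mono mult_left_mono) auto
      finally show ?thesis .
    qed
    have "surv_expect M W \<mu> \<kappa> s f t - f 0 * surv_prob M W \<mu> \<kappa> s t
      = (\<integral>x. (\<integral>\<omega>. f (X x \<omega>) * indicator (S x) \<omega> \<partial>M) - f 0 * prob (S x) \<partial>\<mu>)"
      unfolding surv_expect_def surv_prob_def S_def[symmetric] X_def[symmetric]
      by (subst Bochner_Integration.integral_diff[OF intF integrable_mult_right[OF intS]]) simp
    also have "\<bar>\<dots>\<bar> \<le> (\<integral>x. \<bar>(\<integral>\<omega>. f (X x \<omega>) * indicator (S x) \<omega> \<partial>M) - f 0 * prob (S x)\<bar> \<partial>\<mu>)"
      by (rule integral_abs_bound)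
    also have "\<dots> \<le> (\<integral>x. e + 2 * B * p \<partial>\<mu>)"
    \<comment> \<open>The estimate \<open>inner\<close> holds for starting points in
      \<open>(-1, 1)\<close>, which is \<open>\<mu>\<close>-almost everywhere.\<close>
    proof (rule integral_mono_AE)
      show "AE x in \<mu>. \<bar>(\<integral>\<omega>. f (X x \<omega>) * indicator (S x) \<omega> \<partial>M) - f 0 * prob (S x)\<bar> \<le> e + 2 * B * p"
        using inside by eventually_elim (rule inner)
    qed (auto intro!: integrable_abs Bochner_Integration.integrable_diff intF intS)
    finally show "\<bar>surv_expect M W \<mu> \<kappa> s f t - f 0 * surv_prob M W \<mu> \<kappa> s t\<bar> \<le> e + 2 * B * p"
      by (simp add: \<mu>.prob_space)
  qed

  show "((\<lambda>t. cond_expect M W \<mu> \<kappa> s f t) \<longlongrightarrow> f 0) at_top"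
  proof (rule tendstoI)
    fix \<epsilon> :: real assume \<epsilon>: "0 < \<epsilon>"
    \<comment> \<open>With these values \<open>e + 2 * B * p\<close> equals
      \<open>\<epsilon> * q / 2\<close>, so division by a survival probability of at least
      \<open>q\<close> leaves at most \<open>\<epsilon> / 2\<close>.\<close>
    define e where "e = \<epsilon> * q / 4"
    define p where "p = \<epsilon> * q / (8 * B)"
    have e: "0 < e" and p: "0 < p" using \<epsilon> q B by (auto simp: e_def p_def)
    have "isCont f 0" using cont by (simp add: continuous_on_eq_continuous_at)
    then obtain d where d: "0 < d" "\<And>y. \<bar>y\<bar> < d \<Longrightarrow> \<bar>f y - f 0\<bar> < e"
      using e unfolding continuous_at_eps_delta by (force simp: dist_real_def)
    have fd: "\<bar>f y - f 0\<bar> \<le> e" if "\<bar>y\<bar> \<le> d / 2" for y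
      using d(2)[of y] d(1) that by linarith
    have "0 < d / 2" using d by simp
    from Xproc_tail_le[OF \<kappa> s this p] eventually_ge_at_top[of s]
    show "\<forall>\<^sub>F t in at_top. dist (cond_expect M W \<mu> \<kappa> s f t) (f 0) < \<epsilon>"
    proof eventually_elim
      case (elim t)
      let ?P = "surv_prob M W \<mu> \<kappa> s t" and ?E = "surv_expect M W \<mu> \<kappa> s f t"
      have P: "q \<le> ?P" and E: "\<bar>?E - f 0 * ?P\<bar> \<le> e + 2 * B * p"
        using surv[of t e "d / 2" p] diff[of t e "d / 2" p] elim e p fd by auto
      have "?E / ?P - f 0 = (?E - f 0 * ?P) / ?P" using P q by (simp add: field_simps)
      then have "\<bar>?E / ?P - f 0\<bar> = \<bar>?E - f 0 * ?P\<bar> / ?P" using P q by simp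
      also have "\<dots> \<le> (e + 2 * B * p) / q"
        using E P q by (intro frac_le) auto
      also have "\<dots> = \<epsilon> / 2" using q B by (simp add: e_def p_def field_simps)
      also have "\<dots> < \<epsilon>" using \<epsilon> by simp
      finally show ?case by (simp add: cond_expect_def dist_real_def)
    qed
  qed
qed

end
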